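(* Let $d\ge 3$ and $N\ge 3$ be integers. Let $G$ be a finite abelian group acting linearly and faithfully on a smooth $(N-2)$-fold of degree $d$ in $\mathbb{P}^{N-1}$, such that $\gcd(|G|,d-1)=1$ and the action is liftable. Then one can choose a homogeneous coordinate system $(x_1,\dots,x_N)$ for $\mathbb{P}^{N-1}$ such that there exists a $K$-pure polynomial $F(x_1,\dots,x_N)$ of degree $d$ with $G<G_F$ (that is, the image of $G$ in $\mathrm{PGL}(N,\mathbb{C})$, written in these coordinates, is a subgroup of $G_F$).
   Context: All varieties are over $\mathbb{C}$. A homogeneous polynomial $F(x_1,\dots,x_k)$ ($k\ge 1$) is called smooth if the only common zero in $\mathbb{C}^k$ of $\partial F/\partial x_1,\dots,\partial F/\partial x_k$ is the origin. For a homogeneous polynomial $F$ of degree $d$ in $x_1,\dots,x_N$, $V(F)\subset\mathbb{P}^{N-1}$ is the hypersurface it defines; it is called an $(N-2)$-fold of degree $d$, and it is smooth when $F$ is smooth. A linear action of $G$ on $V(F)$ is a homomorphism $G\to\mathrm{PGL}(N,\mathbb{C})$ whose image preserves $V(F)$; it is faithful if this homomorphism is injective. The action is liftable if there is a group homomorphism $G\to\mathrm{GL}(N,\mathbb{C})$ whose composition with the projection $\mathrm{GL}(N,\mathbb{C})\to\mathrm{PGL}(N,\mathbb{C})$ is the given homomorphism. For $d\ge 3$, $k\ge 1$, a polynomial is of type $K_k$ if, up to naming of variables, it is $x_1^{d-1}x_2+x_2^{d-1}x_3+\cdots+x_k^{d-1}x_1$ (so type $K_1$ is $x_1^d$), and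 of type $T_k$ if, up to naming of variables, it is $x_1^{d-1}x_2+\cdots+x_{k-1}^{d-1}x_k+x_k^d$. A simple polynomial is a sum of finitely many polynomials of type $K$ or $T$ (its components) of the same degree $d$ in pairwise disjoint sets of variables, which together are all the variables. It is $K$-pure if all its components are of type $K$. Simple polynomials of degree at least $3$ are smooth. For a smooth polynomial $F(x_1,\dots,x_N)$, $G_F\subset\mathrm{PGL}(N,\mathbb{C})$ denotes the group of classes $\mathrm{diag}[\lambda_1:\cdots:\lambda_N]$ of invertible diagonal matrices $\mathrm{diag}(\lambda_1,\dots,\lambda_N)$ such that $F(\lambda_1x_1,\dots,\lambda_Nx_N)=\lambda F(x_1,\dots,x_N)$ for some $\lambda\in\mathbb{C}^\times$. *)

theory Defs
  imports
    "HOL-Analysis.Analysis"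
    "HOL-Library.Poly_Mapping"
    "HOL-Algebra.Coset"
begin

section \<open>Polynomials\<close>

text \<open>
  Complex polynomials with one variable for each element of the index type \<open>'n\<close>: finitely
  supported coefficient functions on exponent vectors, with the ring structure of
  \<^theory>\<open>HOL-Library.Poly_Mapping\<close>.
\<close>

type_synonym 'n cpoly = "('n \<Rightarrow>\<^sub>0 nat) \<Rightarrow>\<^sub>0 complex"

definition Var :: "'n \<Rightarrow> 'n cpoly" where
  "Var i = Poly_Mapping.single (Poly_Mapping.single i 1) 1"

definition peval :: "'n::finite cpoly \<Rightarrow> complex ^ 'n \<Rightarrow> complex" where
  "peval F x =
     (\<Sum>m\<in>Poly_Mapping.keys F.
        Poly_Mapping.lookup F m * (\<Prod>i\<in>UNIV. (x $ i) ^ Poly_Mapping.lookup m i))"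

definition homogeneous :: "nat \<Rightarrow> 'n::finite cpoly \<Rightarrow> bool" where
  "homogeneous d F \<longleftrightarrow>
     (\<forall>m\<in>Poly_Mapping.keys F. (\<Sum>i\<in>UNIV. Poly_Mapping.lookup m i) = d)"

text \<open>
  In a monomial not involving the variable \<open>i\<close>, subtraction of exponents truncates, but the
  coefficient is then 0.
\<close>

definition partial_deriv :: "'n \<Rightarrow> 'n cpoly \<Rightarrow> 'n cpoly" where
  "partial_deriv i F =
     (\<Sum>m\<in>Poly_Mapping.keys F.
        Poly_Mapping.single (m - Poly_Mapping.single i 1)
          (of_nat (Poly_Mapping.lookup m i) * Poly_Mapping.lookup F m))"

definition smooth_poly :: "'n::finite cpoly \<Rightarrow> bool" where
  "smooth_poly F \<longleftrightarrow> {x. \<forall>i. peval (partial_deriv i F) x = 0} = {0}"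

text \<open>
  The polynomial of type \<open>K\<close> on the cyclically ordered variables \<open>xs\<close>; a one-element
  list \<open>[i]\<close> gives \<open>Var i ^ d\<close>.
\<close>

definition K_poly :: "nat \<Rightarrow> 'n list \<Rightarrow> 'n cpoly" where
  "K_poly d xs =
     (\<Sum>j<length xs. Var (xs ! j) ^ (d - 1) * Var (xs ! (Suc j mod length xs)))"

text \<open>
  The members of \<open>xss\<close> list the variables of the components: each is nonempty, and distinctness
  of \<open>concat xss\<close> says that no variable is repeated within a component or shared by two of them.
\<close>

definition K_pure :: "nat \<Rightarrow> 'n cpoly \<Rightarrow> bool" where
  "K_pure d F \<longleftrightarrow>
     (\<exists>xss. [] \<notin> set xss \<and> distinct (concat xss) \<and> set (concat xss) = UNIV \<and>
            F = (\<Sum>xs\<leftarrow>xss. K_poly d xs))"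

section \<open>Projective linear groups and projective hypersurfaces\<close>

definition GL :: "(complex ^ 'n ^ 'n) monoid" where
  "GL = \<lparr>carrier = {A. invertible A}, mult = (**), one = mat 1\<rparr>"

definition scalar_matrices :: "(complex ^ 'n ^ 'n) set" where
  "scalar_matrices = {mat c | c. c \<noteq> 0}"

definition PGL :: "(complex ^ 'n ^ 'n) set monoid" where
  "PGL = GL Mod scalar_matrices"

definition PGL_class :: "complex ^ 'n ^ 'n \<Rightarrow> (complex ^ 'n ^ 'n) set" where
  "PGL_class A = scalar_matrices #>\<^bsub>GL\<^esub> A"

text \<open>A point of projective space is the set of its homogeneous coordinate vectors.\<close>

definition proj_point :: "complex ^ 'n \<Rightarrow> (complex ^ 'n) set" where
  "proj_point x = {c *s x | c. c \<noteq> 0}"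

definition hypersurface :: "'n::finite cpoly \<Rightarrow> (complex ^ 'n) set set" where
  "hypersurface F = {proj_point x | x. x \<noteq> 0 \<and> peval F x = 0}"

definition PGL_act :: "(complex ^ 'n ^ 'n) set \<Rightarrow> (complex ^ 'n) set \<Rightarrow> (complex ^ 'n) set" where
  "PGL_act P p = {A *v x | A x. A \<in> P \<and> x \<in> p}"

section \<open>Linear actions\<close>

definition linear_action ::
    "('a, 'b) monoid_scheme \<Rightarrow> 'n::finite cpoly \<Rightarrow> ('a \<Rightarrow> (complex ^ 'n ^ 'n) set) \<Rightarrow> bool" where
  "linear_action G F \<rho> \<longleftrightarrow>
     \<rho> \<in> hom G PGL \<and>
     (\<forall>g\<in>carrier G. PGL_act (\<rho> g) ` hypersurface F = hypersurface F)"

definition faithful_action ::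
    "('a, 'b) monoid_scheme \<Rightarrow> ('a \<Rightarrow> (complex ^ 'n ^ 'n) set) \<Rightarrow> bool" where
  "faithful_action G \<rho> \<longleftrightarrow> inj_on \<rho> (carrier G)"

definition liftable ::
    "('a, 'b) monoid_scheme \<Rightarrow> ('a \<Rightarrow> (complex ^ 'n ^ 'n) set) \<Rightarrow> bool" where
  "liftable G \<rho> \<longleftrightarrow> (\<exists>\<sigma> \<in> hom G GL. \<forall>g\<in>carrier G. PGL_class (\<sigma> g) = \<rho> g)"

definition diag_matrix :: "complex ^ 'n \<Rightarrow> complex ^ 'n ^ 'n" where
  "diag_matrix l = (\<chi> i j. if i = j then l $ i else 0)"

text \<open>
  The group $G_F$, as a subset of \<^const>\<open>PGL\<close>. As the field is infinite, the identity
  $F(\lambda_1 x_1, \dots, \lambda_N x_N) = \lambda F(x_1, \dots, x_N)$ of polynomials is stated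
  as an identity of functions.
\<close>

definition diag_sym :: "'n::finite cpoly \<Rightarrow> (complex ^ 'n ^ 'n) set set" where
  "diag_sym F =
     {PGL_class (diag_matrix l) | l.
        (\<forall>i. l $ i \<noteq> 0) \<and>
        (\<exists>c. c \<noteq> 0 \<and> (\<forall>x. peval F (\<chi> i. l $ i * x $ i) = c * peval F x))}"

end

theory Submission
  imports
    Defs
    "HOL-Computational_Algebra.Fundamental_Theorem_Algebra"
    "HOL-Combinatorics.Cycles"
    "HOL-Algebra.FiniteProduct"
begin

text \<open>
  A lift of the action to \<open>GL\<close> consists of commuting matrices of finite order, so there are
  coordinates \<open>x\<^sub>1, \<dots>, x\<^sub>n\<close> in which all of them are diagonal; let \<open>\<psi>\<^sub>i\<close> be the character of \<open>G\<close> on the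
  \<open>i\<close>-th basis vector (\<open>simultaneous_diagonalization\<close>). The group preserves the hypersurface as
  a set of points, and since \<open>F\<close> is smooth this makes \<open>F\<close> semi-invariant with some character \<open>\<kappa>\<close>
  (\<open>invariant_hypersurface_semi_invariant\<close>).

  It suffices to find a permutation \<open>\<pi>\<close> of the indices with
  \<open>\<psi>\<^sub>i\<^sup>d\<^sup>-\<^sup>1 \<psi>\<^bsub>\<pi> i\<^esub> = \<kappa>\<close> for all \<open>i\<close>: then every monomial \<open>x\<^sub>i\<^sup>d\<^sup>-\<^sup>1 x\<^bsub>\<pi> i\<^esub>\<close> is semi-invariant with
  character \<open>\<kappa>\<close>, and their sum is the \<open>K\<close>-pure polynomial whose components are the cycles of \<open>\<pi>\<close>.

  Let \<open>W\<close> be the eigenspace of a character \<open>\<alpha>\<close>. By semi-invariance, a partial derivative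
  \<open>\<partial>F/\<partial>x\<^sub>k\<close> vanishes on \<open>W\<close> unless \<open>\<psi>\<^sub>k = \<kappa> / \<alpha>\<^sup>d\<^sup>-\<^sup>1\<close>. If fewer than \<open>dim W\<close> indices \<open>k\<close> had this
  character, the corresponding derivatives would have a common zero in \<open>W\<close> besides the origin, and
  \<open>F\<close> would not be smooth. So \<open>\<alpha>\<close> occurs at most as often as \<open>\<kappa> / \<alpha>\<^sup>d\<^sup>-\<^sup>1\<close>
  (\<open>card_character_class_le\<close>). Because \<open>d - 1\<close> is prime to the order of \<open>G\<close>, the map
  \<open>\<alpha> \<mapsto> \<kappa> / \<alpha>\<^sup>d\<^sup>-\<^sup>1\<close> is injective on characters, and injections between the index sets of \<open>\<alpha>\<close> and of its
  image fit together to a permutation (\<open>character_permutation\<close>).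

  Two facts of algebraic geometry enter. The first is that fewer than \<open>n\<close> forms of positive degree in
  \<open>n\<close> variables have a common nontrivial zero (\<open>common_zero_of_few_forms\<close>). It follows from the weak
  Nullstellensatz, which over the uncountable field \<open>\<complex>\<close> has a short proof by linear algebra, and from a
  count of monomials. The second is that \<open>F \<circ> A\<close> is a multiple of \<open>F\<close> if it vanishes on the
  smooth hypersurface \<open>F = 0\<close> of degree \<open>d\<close>. This is reduced to univariate polynomials by restricting both
  to lines that meet the hypersurface in \<open>d\<close> distinct points (\<open>transversal_line_exists\<close>).
\<close>

section \<open>Evaluation and differentiation of polynomials\<close>

lemma cpoly_sum_monomials:
  "(p :: 'n cpoly) = (\<Sum>m\<in>Poly_Mapping.keys p. Poly_Mapping.single m (Poly_Mapping.lookup p m))"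
proof (rule poly_mapping_eqI)
  fix k
  have "Poly_Mapping.lookup (\<Sum>m\<in>Poly_Mapping.keys p. Poly_Mapping.single m (Poly_Mapping.lookup p m)) k
      = (\<Sum>m\<in>Poly_Mapping.keys p. if m = k then Poly_Mapping.lookup p m else 0)"
    by (simp add: lookup_sum lookup_single when_def)
  also have "\<dots> = Poly_Mapping.lookup p k"
    by (simp add: sum.delta' in_keys_iff)
  finally show "Poly_Mapping.lookup p k = Poly_Mapping.lookup
      (\<Sum>m\<in>Poly_Mapping.keys p. Poly_Mapping.single m (Poly_Mapping.lookup p m)) k" by simp
qed

lemma cpoly_induct [case_names monomial add]:
  fixes p :: "'n cpoly"
  assumes single: "\<And>m a. P (Poly_Mapping.single m a)"
    and add: "\<And>p q. P p \<Longrightarrow> P q \<Longrightarrow> P (p + q)"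
  shows "P p"
proof -
  have "P (\<Sum>m\<in>S. Poly_Mapping.single m (Poly_Mapping.lookup p m))" if "finite S" for S
    using that
  proof induction
    case empty
    show ?case using single[of 0 0] by simp
  qed (simp add: single add)
  from this[of "Poly_Mapping.keys p"] show ?thesis
    by (simp flip: cpoly_sum_monomials)
qed

lemma peval_superset:
  fixes F :: "'n::finite cpoly"
  assumes "finite S" "Poly_Mapping.keys F \<subseteq> S"
  shows "peval F x = (\<Sum>m\<in>S. Poly_Mapping.lookup F m * (\<Prod>i\<in>UNIV. (x $ i) ^ Poly_Mapping.lookup m i))"
  unfolding peval_def using assms
  by (intro sum.mono_neutral_left) (auto simp: in_keys_iff)

lemma peval_add: "peval (p + q) x = peval p x + peval q (x :: complex ^ 'n::finite)"
proof -
  let ?S = "Poly_Mapping.keys p \<union> Poly_Mapping.keys q"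
  have "Poly_Mapping.keys (p + q) \<subseteq> ?S" by (rule keys_add)
  then show ?thesis
    by (simp add: peval_superset[of ?S] lookup_add algebra_simps sum.distrib)
qed

lemma peval_single:
  "peval (Poly_Mapping.single m a) (x :: complex ^ 'n::finite)
     = a * (\<Prod>i\<in>UNIV. (x $ i) ^ Poly_Mapping.lookup m i)"
  by (subst peval_superset[of "{m}"]) auto

lemma peval_0 [simp]: "peval 0 (x :: complex ^ 'n::finite) = 0"
  by (simp add: peval_def)

lemma peval_1 [simp]: "peval 1 (x :: complex ^ 'n::finite) = 1"
  using peval_single[of 0 1 x] by simp

lemma peval_mult: "peval (p * q) x = peval p x * peval q (x :: complex ^ 'n::finite)"
proof (induction p rule: cpoly_induct)
  case (monomial m a)
  show ?case
    by (induction q rule: cpoly_induct)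
      (simp_all add: mult_single peval_single peval_add lookup_add power_add prod.distrib algebra_simps)
qed (simp add: peval_add algebra_simps)

lemma peval_uminus: "peval (- p) x = - peval p (x :: complex ^ 'n::finite)"
  using peval_add[of p "- p" x] by (simp add: eq_neg_iff_add_eq_0 add.commute)

lemma peval_diff: "peval (p - q) x = peval p x - peval q (x :: complex ^ 'n::finite)"
  using peval_add[of p "- q" x] by (simp add: peval_uminus)

lemma peval_sum: "peval (\<Sum>i\<in>S. f i) x = (\<Sum>i\<in>S. peval (f i) (x :: complex ^ 'n::finite))"
  by (induction S rule: infinite_finite_induct) (simp_all add: peval_add)

lemma peval_power: "peval (p ^ k) x = peval p (x :: complex ^ 'n::finite) ^ k"
  by (induction k) (simp_all add: peval_mult)

lemma peval_Var [simp]: "peval (Var i) (x :: complex ^ 'n::finite) = x $ i"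
proof -
  have "(\<Prod>j\<in>UNIV. (x $ j) ^ Poly_Mapping.lookup (Poly_Mapping.single i 1) j)
      = (\<Prod>j\<in>UNIV. if j = i then x $ j else 1)"
    by (intro prod.cong) (auto simp: lookup_single when_def)
  then show ?thesis by (simp add: Var_def peval_single)
qed

definition Const :: "complex \<Rightarrow> 'n cpoly" where
  "Const c = Poly_Mapping.single 0 c"

lemma Const_0 [simp]: "Const 0 = 0" and Const_1 [simp]: "Const 1 = 1"
  by (simp_all add: Const_def)

lemma Const_add: "Const (a + b) = Const a + Const b"
  by (simp add: Const_def single_add)

lemma Const_mult: "Const (a * b) = Const a * Const b"
  by (simp add: Const_def mult_single)

lemma Const_uminus: "Const (- a) = - Const a"
  by (simp add: Const_def single_uminus)

lemma peval_Const [simp]: "peval (Const c) (x :: complex ^ 'n::finite) = c"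
  by (simp add: Const_def peval_single)

lemma Const_mult_single: "Const c * Poly_Mapping.single m a = Poly_Mapping.single m (c * a)"
  by (simp add: Const_def mult_single)

lemma lookup_Const_mult: "Poly_Mapping.lookup (Const c * p) m = c * Poly_Mapping.lookup p m"
proof (induction p rule: cpoly_induct)
  case (monomial k a)
  then show ?case by (simp add: Const_mult_single lookup_single when_def)
qed (simp add: algebra_simps lookup_add)

lemma Var_power: "Var i ^ k = Poly_Mapping.single (Poly_Mapping.single i k) 1"
  by (induction k) (simp_all add: Var_def mult_single single_add[symmetric])

lemma single_eq_prod_Var:
  fixes m :: "'n::finite \<Rightarrow>\<^sub>0 nat"
  shows "Poly_Mapping.single m a = Const a * (\<Prod>i\<in>UNIV. Var i ^ Poly_Mapping.lookup m i)"
proof -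
  have "(\<Prod>i\<in>S. Var i ^ Poly_Mapping.lookup m i)
      = Poly_Mapping.single (\<Sum>i\<in>S. Poly_Mapping.single i (Poly_Mapping.lookup m i)) 1"
    if "finite S" for S
    using that by induction (simp_all add: Var_power mult_single)
  moreover have "(\<Sum>i\<in>UNIV. Poly_Mapping.single i (Poly_Mapping.lookup m i)) = m"
    by (rule poly_mapping_eqI) (simp add: lookup_sum lookup_single when_def)
  ultimately show ?thesis by (simp add: Const_mult_single)
qed

lemma partial_deriv_superset:
  assumes "finite S" "Poly_Mapping.keys F \<subseteq> S"
  shows "partial_deriv i F = (\<Sum>m\<in>S. Poly_Mapping.single (m - Poly_Mapping.single i 1)
          (of_nat (Poly_Mapping.lookup m i) * Poly_Mapping.lookup F m))"
  unfolding partial_deriv_def using assms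
  by (intro sum.mono_neutral_left) (auto simp: in_keys_iff)

lemma partial_deriv_single:
  "partial_deriv i (Poly_Mapping.single m a)
     = Poly_Mapping.single (m - Poly_Mapping.single i 1) (of_nat (Poly_Mapping.lookup m i) * a)"
  by (subst partial_deriv_superset[of "{m}"]) auto

lemma partial_deriv_add: "partial_deriv i (p + q) = partial_deriv i p + partial_deriv i q"
proof -
  let ?S = "Poly_Mapping.keys p \<union> Poly_Mapping.keys q"
  have "Poly_Mapping.keys (p + q) \<subseteq> ?S" by (rule keys_add)
  then show ?thesis
    by (simp add: partial_deriv_superset[of ?S] lookup_add algebra_simps sum.distrib single_add)
qed

text \<open>
  This lets identities between partial derivatives be derived by differentiating identities between
  polynomial functions along lines.
\<close>

lemma peval_has_derivative_line:
  fixes F :: "'n::finite cpoly"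
  shows "((\<lambda>t. peval F (x + t *s v)) has_field_derivative
           (\<Sum>i\<in>UNIV. v $ i * peval (partial_deriv i F) (x + t *s v))) (at t)"
proof (induction F rule: cpoly_induct)
  case (monomial m a)
  let ?y = "\<lambda>t. x + t *s v"
  let ?m = "Poly_Mapping.lookup m"
  have "((\<lambda>t. (?y t $ i) ^ ?m i) has_field_derivative
           of_nat (?m i) * v $ i * (?y t $ i) ^ (?m i - 1)) (at t)" for i
    by (auto intro!: derivative_eq_intros)
  then have "((\<lambda>t. a * (\<Prod>i\<in>UNIV. (?y t $ i) ^ ?m i)) has_field_derivative
      a * (\<Sum>i\<in>UNIV. (of_nat (?m i) * v $ i * (?y t $ i) ^ (?m i - 1)) * (\<Prod>j\<in>UNIV - {i}. (?y t $ j) ^ ?m j))) (at t)"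
    by (intro DERIV_cmult has_field_derivative_prod) auto
  also have "a * (\<Sum>i\<in>UNIV. (of_nat (?m i) * v $ i * (?y t $ i) ^ (?m i - 1)) * (\<Prod>j\<in>UNIV - {i}. (?y t $ j) ^ ?m j))
     = (\<Sum>i\<in>UNIV. v $ i * peval (partial_deriv i (Poly_Mapping.single m a)) (?y t))"
    unfolding sum_distrib_left
  proof (intro sum.cong refl)
    fix i :: 'n
    have "(\<Prod>j\<in>UNIV. (?y t $ j) ^ Poly_Mapping.lookup (m - Poly_Mapping.single i 1) j)
        = (?y t $ i) ^ (?m i - 1) * (\<Prod>j\<in>UNIV - {i}. (?y t $ j) ^ Poly_Mapping.lookup (m - Poly_Mapping.single i 1) j)"
      by (subst prod.remove[of UNIV i]) (auto simp: lookup_minus)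
    also have "(\<Prod>j\<in>UNIV - {i}. (?y t $ j) ^ Poly_Mapping.lookup (m - Poly_Mapping.single i 1) j)
        = (\<Prod>j\<in>UNIV - {i}. (?y t $ j) ^ ?m j)"
      by (intro prod.cong) (auto simp: lookup_minus lookup_single when_def)
    finally show "a * (of_nat (?m i) * v $ i * (?y t $ i) ^ (?m i - 1) * (\<Prod>j\<in>UNIV - {i}. (?y t $ j) ^ ?m j))
        = v $ i * peval (partial_deriv i (Poly_Mapping.single m a)) (?y t)"
      by (simp add: partial_deriv_single peval_single mult_ac)
  qed
  finally show ?case by (simp add: peval_single)
next
  case (add p q)
  then show ?case
    by (simp add: peval_add partial_deriv_add algebra_simps sum.distrib DERIV_add)
qed

subsection \<open>Homogeneous polynomials\<close>

lemma homogeneousD: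
  "homogeneous d F \<Longrightarrow> m \<in> Poly_Mapping.keys F \<Longrightarrow> (\<Sum>i\<in>UNIV. Poly_Mapping.lookup m i) = d"
  by (simp add: homogeneous_def)

lemma homogeneous_single:
  "(\<Sum>i\<in>UNIV. Poly_Mapping.lookup m i) = d \<Longrightarrow> homogeneous d (Poly_Mapping.single m a)"
  by (auto simp: homogeneous_def split: if_splits)

lemma homogeneous_0 [simp]: "homogeneous d 0"
  by (simp add: homogeneous_def)

lemma homogeneous_add: "homogeneous d p \<Longrightarrow> homogeneous d q \<Longrightarrow> homogeneous d (p + q)"
  using keys_add[of p q] by (auto simp: homogeneous_def)

lemma homogeneous_sum: "(\<And>i. i \<in> S \<Longrightarrow> homogeneous d (f i)) \<Longrightarrow> homogeneous d (\<Sum>i\<in>S. f i)"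
  by (induction S rule: infinite_finite_induct) (simp_all add: homogeneous_add)

lemma homogeneous_mult:
  assumes "homogeneous a p" "homogeneous b q"
  shows "homogeneous (a + b) (p * q)"
  unfolding homogeneous_def
proof
  fix m assume "m \<in> Poly_Mapping.keys (p * q)"
  then obtain k l where "k \<in> Poly_Mapping.keys p" "l \<in> Poly_Mapping.keys q" "m = k + l"
    using keys_mult[of p q] by auto
  then show "(\<Sum>i\<in>UNIV. Poly_Mapping.lookup m i) = a + b"
    using homogeneousD[OF assms(1)] homogeneousD[OF assms(2)] by (simp add: lookup_add sum.distrib)
qed

lemma homogeneous_Const: "homogeneous 0 (Const c)"
  unfolding Const_def by (rule homogeneous_single) simp

lemma homogeneous_Const_mult: "homogeneous d p \<Longrightarrow> homogeneous d (Const c * p)"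
  using homogeneous_mult[OF homogeneous_Const] by fastforce

lemma homogeneous_Var: "homogeneous 1 (Var i)"
  unfolding Var_def by (rule homogeneous_single) (simp add: lookup_single when_def)

lemma homogeneous_partial_deriv:
  assumes "homogeneous d F"
  shows "homogeneous (d - 1) (partial_deriv i F)"
  unfolding partial_deriv_def
proof (rule homogeneous_sum)
  fix m assume m: "m \<in> Poly_Mapping.keys F"
  show "homogeneous (d - 1) (Poly_Mapping.single (m - Poly_Mapping.single i 1)
         (of_nat (Poly_Mapping.lookup m i) * Poly_Mapping.lookup F m))"
  proof (cases "Poly_Mapping.lookup m i = 0")
    case False
    have "(\<Sum>j\<in>UNIV. Poly_Mapping.lookup (m - Poly_Mapping.single i 1) j)
        = (Poly_Mapping.lookup m i - 1) + (\<Sum>j\<in>UNIV - {i}. Poly_Mapping.lookup m j)"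
      by (subst sum.remove[of UNIV i]) (auto simp: lookup_minus lookup_single when_def intro!: sum.cong)
    moreover have "d = Poly_Mapping.lookup m i + (\<Sum>j\<in>UNIV - {i}. Poly_Mapping.lookup m j)"
      using homogeneousD[OF assms m] by (subst (asm) sum.remove[of UNIV i]) auto
    ultimately show ?thesis using False by (intro homogeneous_single) simp
  qed simp
qed

lemma peval_scale:
  fixes x :: "complex ^ 'n::finite"
  assumes "homogeneous d F"
  shows "peval F (c *s x) = c ^ d * peval F x"
  unfolding peval_def sum_distrib_left
  using homogeneousD[OF assms]
  by (intro sum.cong refl) (simp add: power_mult_distrib prod.distrib power_sum[symmetric] mult_ac)

section \<open>The weak Nullstellensatz over the complex numbers\<close>

interpretation ideal: module "(*) :: 'n cpoly \<Rightarrow> 'n cpoly \<Rightarrow> 'n cpoly"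
  by unfold_locales (simp_all only: distrib_left distrib_right mult.assoc mult_1_left)

interpretation coeffs: vector_space "\<lambda>c p. Const c * p :: 'n cpoly"
  by unfold_locales (simp_all only: Const_add Const_mult Const_1 distrib_left distrib_right mult.assoc mult_1_left)

(* Both rules reassociate products to the left and so loop with algebra_simps. *)
declare ideal.scale_scale [simp del] coeffs.scale_scale [simp del]

definition maximal_ideal :: "'n cpoly set \<Rightarrow> bool" where
  "maximal_ideal M \<longleftrightarrow> ideal.subspace M \<and> 1 \<notin> M \<and>
     (\<forall>J. ideal.subspace J \<longrightarrow> M \<subseteq> J \<longrightarrow> 1 \<notin> J \<longrightarrow> J = M)"

lemma maximal_ideal_exists:
  assumes "ideal.subspace I" "1 \<notin> I"
  obtains M where "maximal_ideal M" "I \<subseteq> M"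
proof -
  let ?A = "{J. ideal.subspace J \<and> I \<subseteq> J \<and> 1 \<notin> J}"
  have "\<exists>M\<in>?A. \<forall>X\<in>?A. M \<subseteq> X \<longrightarrow> X = M"
  proof (rule subset_Zorn_nonempty)
    show "?A \<noteq> {}" using assms by blast
    fix \<C> assume ne: "\<C> \<noteq> {}" and ch: "subset.chain ?A \<C>"
    have sub: "\<C> \<subseteq> ?A" and tot: "\<And>X Y. X \<in> \<C> \<Longrightarrow> Y \<in> \<C> \<Longrightarrow> X \<subseteq> Y \<or> Y \<subseteq> X"
      using ch by (auto simp: subset_chain_def)
    have sp: "ideal.subspace J" if "J \<in> \<C>" for J using sub that by auto
    have "ideal.subspace (\<Union>\<C>)"
    proof (rule ideal.subspaceI)
      show "0 \<in> \<Union>\<C>" using ne sp ideal.subspace_0 by blast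
    next
      fix x y assume "x \<in> \<Union>\<C>" "y \<in> \<Union>\<C>"
      then obtain X Y where XY: "X \<in> \<C>" "Y \<in> \<C>" "x \<in> X" "y \<in> Y" by blast
      then obtain Z where "Z \<in> \<C>" "x \<in> Z" "y \<in> Z" using tot[of X Y] by blast
      then show "x + y \<in> \<Union>\<C>" using sp ideal.subspace_add by blast
    next
      fix c x assume "x \<in> \<Union>\<C>"
      then show "c * x \<in> \<Union>\<C>" using sp ideal.subspace_scale by blast
    qed
    then show "\<Union>\<C> \<in> ?A" using ne sub by blast
  qed
  then obtain M where MA: "M \<in> ?A" and max: "\<forall>X\<in>?A. M \<subseteq> X \<longrightarrow> X = M" ..
  have "maximal_ideal M"
    unfolding maximal_ideal_def
  proof (intro conjI allI impI)
    fix J assume "ideal.subspace J" "M \<subseteq> J" "1 \<notin> J"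
    with MA max show "J = M" by (metis (mono_tags, lifting) mem_Collect_eq subset_trans)
  qed (use MA in simp_all)
  then show ?thesis using that MA by simp
qed

lemma maximal_ideal_subspace: "maximal_ideal M \<Longrightarrow> ideal.subspace M"
  by (simp add: maximal_ideal_def)

lemma maximal_ideal_inverse:
  assumes M: "maximal_ideal M" and x: "x \<notin> M"
  obtains q where "q * x - 1 \<in> M"
proof -
  note sM = maximal_ideal_subspace[OF M]
  let ?J = "{m + r * x | m r. m \<in> M}"
  have "ideal.subspace ?J"
  proof (rule ideal.subspaceI)
    show "0 \<in> ?J" using ideal.subspace_0[OF sM] by (force intro: exI[of _ 0])
  next
    fix y z assume "y \<in> ?J" "z \<in> ?J"
    then obtain m r m' r' where "y = m + r * x" "z = m' + r' * x" "m \<in> M" "m' \<in> M" by blast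
    moreover then have "y + z = (m + m') + (r + r') * x" by (simp add: algebra_simps)
    ultimately show "y + z \<in> ?J" using ideal.subspace_add[OF sM] by blast
  next
    fix c y assume "y \<in> ?J"
    then obtain m r where y: "y = m + r * x" "m \<in> M" by blast
    have "c * y = c * m + (c * r) * x" unfolding y(1) by (simp only: distrib_left mult.assoc)
    then show "c * y \<in> ?J" using ideal.subspace_scale[OF sM y(2)] by blast
  qed
  moreover have "M \<subseteq> ?J"
  proof
    fix m assume "m \<in> M"
    then have "m = m + 0 * x \<and> m \<in> M" by simp
    then show "m \<in> ?J" by blast
  qed
  moreover have "x \<in> ?J"
  proof -
    have "x = 0 + 1 * x \<and> 0 \<in> M" using ideal.subspace_0[OF sM] by simp
    then show ?thesis by blast
  qed
  ultimately have "1 \<in> ?J" using M x unfolding maximal_ideal_def by blast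
  then obtain m r where mr: "1 = m + r * x" "m \<in> M" by blast
  have "r * x - 1 = - m" by (subst mr(1)) simp
  then show ?thesis using that ideal.subspace_neg[OF sM mr(2)] by metis
qed

lemma maximal_ideal_prime:
  assumes M: "maximal_ideal M" and xy: "x * y \<in> M" and x: "x \<notin> M"
  shows "y \<in> M"
proof -
  note sM = maximal_ideal_subspace[OF M]
  obtain q where q: "q * x - 1 \<in> M" using maximal_ideal_inverse[OF M x] .
  have "q * (x * y) - y * (q * x - 1) \<in> M"
    by (intro ideal.subspace_diff[OF sM ideal.subspace_scale[OF sM xy] ideal.subspace_scale[OF sM q]])
  then show ?thesis by (simp add: algebra_simps)
qed

lemma Const_notin_maximal_ideal:
  assumes M: "maximal_ideal M" and "c \<noteq> 0"
  shows "Const c \<notin> M"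
proof
  assume "Const c \<in> M"
  then have "Const (1 / c) * Const c \<in> M"
    using ideal.subspace_scale[OF maximal_ideal_subspace[OF M]] by blast
  then have "1 \<in> M" using \<open>c \<noteq> 0\<close> by (simp flip: Const_mult)
  then show False using M by (simp add: maximal_ideal_def)
qed

subsection \<open>Substituting a polynomial into a univariate polynomial\<close>

definition subst_poly :: "complex poly \<Rightarrow> 'n cpoly \<Rightarrow> 'n cpoly" where
  "subst_poly p X = poly (map_poly Const p) X"

lemma subst_poly_pCons [simp]: "subst_poly (pCons a p) X = Const a + X * subst_poly p X"
  by (simp add: subst_poly_def map_poly_pCons)

lemma subst_poly_0 [simp]: "subst_poly 0 X = 0"
  by (simp add: subst_poly_def)

lemma subst_poly_add: "subst_poly (p + q) X = subst_poly p X + subst_poly q X"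
proof -
  have "map_poly Const (p + q) = map_poly Const p + (map_poly Const q :: 'a cpoly poly)"
    by (rule poly_eqI) (simp add: coeff_map_poly Const_add)
  then show ?thesis by (simp add: subst_poly_def)
qed

lemma subst_poly_smult: "subst_poly (smult a p) X = Const a * subst_poly p X"
  by (induction p) (simp_all add: Const_mult algebra_simps)

lemma subst_poly_mult: "subst_poly (p * q) X = subst_poly p X * subst_poly q X"
  by (induction p) (simp_all add: subst_poly_add subst_poly_smult algebra_simps)

lemma subst_poly_1 [simp]: "subst_poly 1 X = 1"
  by (simp add: one_pCons)

lemma subst_poly_prod: "subst_poly (\<Prod>i\<in>S. f i) X = (\<Prod>i\<in>S. subst_poly (f i) X)"
  by (induction S rule: infinite_finite_induct) (simp_all add: subst_poly_mult)

lemma subst_poly_sum: "subst_poly (\<Sum>i\<in>S. f i) X = (\<Sum>i\<in>S. subst_poly (f i) X)"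
  by (induction S rule: infinite_finite_induct) (simp_all add: subst_poly_add)

text \<open>
  The residue field of a maximal ideal is a field extension of the algebraically closed field
  \<open>\<complex>\<close>, so an element that is algebraic over \<open>\<complex>\<close> is congruent to a constant.
\<close>

lemma maximal_ideal_algebraic:
  assumes M: "maximal_ideal M"
  shows "p \<noteq> 0 \<Longrightarrow> subst_poly p X \<in> M \<Longrightarrow> \<exists>c. X - Const c \<in> M"
proof (induction "degree p" arbitrary: p)
  case 0
  then obtain a where a: "p = [:a:]" by (metis degree_eq_zeroE)
  then have "a \<noteq> 0" using 0 by auto
  then show ?case using 0 a Const_notin_maximal_ideal[OF M] by auto
next
  case (Suc k)
  then have "\<not> constant (poly p)" by (simp add: constant_degree)
  then obtain z where "poly p z = 0" using fundamental_theorem_of_algebra by blast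
  then obtain q where q: "p = [:- z, 1:] * q" by (metis dvdE poly_eq_0_iff_dvd)
  then have "q \<noteq> 0" using Suc.prems by auto
  moreover have "degree p = Suc (degree q)" using q \<open>q \<noteq> 0\<close> by (simp add: degree_mult_eq del: mult_pCons_left)
  then have "k = degree q" using Suc.hyps by simp
  moreover have "subst_poly p X = (X - Const z) * subst_poly q X"
    unfolding q subst_poly_mult by (simp add: Const_uminus)
  ultimately show ?case using Suc maximal_ideal_prime[OF M] by metis
qed

subsection \<open>Residue fields are countably generated\<close>

definition bounded_monomials :: "nat \<Rightarrow> 'n cpoly set" where
  "bounded_monomials D = (\<lambda>m. Poly_Mapping.single m 1) ` {m. \<forall>i. Poly_Mapping.lookup m i < D}"

lemma card_bounded_exponents:
  "finite {m :: 'n::finite \<Rightarrow>\<^sub>0 nat. \<forall>i. Poly_Mapping.lookup m i < D}"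
  "card {m :: 'n::finite \<Rightarrow>\<^sub>0 nat. \<forall>i. Poly_Mapping.lookup m i < D} = D ^ CARD('n)"
proof -
  have "bij_betw Poly_Mapping.lookup {m :: 'n \<Rightarrow>\<^sub>0 nat. \<forall>i. Poly_Mapping.lookup m i < D}
         (PiE UNIV (\<lambda>_. {..<D}))"
  proof (rule bij_betwI[where g = "Abs_poly_mapping"])
  qed (auto simp: Pi_def)
  then show "finite {m :: 'n \<Rightarrow>\<^sub>0 nat. \<forall>i. Poly_Mapping.lookup m i < D}"
    "card {m :: 'n \<Rightarrow>\<^sub>0 nat. \<forall>i. Poly_Mapping.lookup m i < D} = D ^ CARD('n)"
    by (auto simp: bij_betw_finite bij_betw_same_card card_PiE finite_PiE)
qed

lemma finite_bounded_monomials [simp]: "finite (bounded_monomials D :: 'n::finite cpoly set)"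
  unfolding bounded_monomials_def by (intro finite_imageI card_bounded_exponents)

lemma in_span_bounded_monomials:
  fixes p :: "'n::finite cpoly"
  assumes "\<And>m i. m \<in> Poly_Mapping.keys p \<Longrightarrow> Poly_Mapping.lookup m i < D"
  shows "p \<in> coeffs.span (bounded_monomials D)"
proof -
  have "(\<Sum>m\<in>Poly_Mapping.keys p. Const (Poly_Mapping.lookup p m) * Poly_Mapping.single m 1)
      \<in> coeffs.span (bounded_monomials D)"
    using assms by (intro coeffs.span_sum coeffs.span_scale coeffs.span_base) (auto simp: bounded_monomials_def)
  then show ?thesis by (simp add: Const_mult_single flip: cpoly_sum_monomials)
qed

lemma in_some_span_bounded_monomials:
  fixes p :: "'n::finite cpoly"
  obtains D where "p \<in> coeffs.span (bounded_monomials D)"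
proof -
  let ?E = "(\<lambda>(m, i). Poly_Mapping.lookup m i) ` (Poly_Mapping.keys p \<times> UNIV)"
  have "finite ?E" by simp
  then have "Poly_Mapping.lookup m i < Suc (Max ?E)" if "m \<in> Poly_Mapping.keys p" for m i
    using that by (force intro: le_imp_less_Suc Max_ge)
  then show ?thesis using that in_span_bounded_monomials by blast
qed

text \<open>
  Residue fields of \<open>\<complex>[x\<^sub>1, \<dots>, x\<^sub>n]\<close> have countable dimension over \<open>\<complex>\<close>. If \<open>X\<close> were congruent
  to no constant, then all the inverses \<open>1 / (X - c)\<close> would exist in the residue field; as there
  are uncountably many, finitely many of them are linearly dependent, and clearing denominators in
  the dependence shows that \<open>X\<close> is algebraic after all.
\<close>

lemma maximal_ideal_residue_Const:
  fixes X :: "'n::finite cpoly"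
  assumes M: "maximal_ideal M"
  shows "\<exists>c. X - Const c \<in> M"
proof (rule ccontr)
  assume "\<nexists>c. X - Const c \<in> M"
  then have "\<forall>c. \<exists>q. q * (X - Const c) - 1 \<in> M" using maximal_ideal_inverse[OF M] by metis
  then obtain q where q: "\<And>c. q c * (X - Const c) - 1 \<in> M" by metis
  note sM = maximal_ideal_subspace[OF M]
  \<comment> \<open>Two equal inverses would give \<open>q c (c - c') \<in> M\<close>, hence \<open>q c \<in> M\<close> and \<open>1 \<in> M\<close>.\<close>
  have injq: "inj q"
  proof (rule injI, rule ccontr)
    fix c c' assume eq: "q c = q c'" and ne: "c \<noteq> c'"
    have "(q c' * (X - Const c') - 1) - (q c * (X - Const c) - 1) \<in> M"
      by (intro ideal.subspace_diff sM q)
    then have "q c * Const (c - c') \<in> M"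
      unfolding eq by (simp add: algebra_simps Const_add[of c "- c'", simplified Const_uminus, simplified])
    then have "q c \<in> M"
      using maximal_ideal_prime[OF M, of "Const (c - c')" "q c"] Const_notin_maximal_ideal[OF M] ne
      by (simp add: mult.commute)
    then have "(X - Const c) * q c - (q c * (X - Const c) - 1) \<in> M"
      by (intro ideal.subspace_diff ideal.subspace_scale sM q)
    then show False using M by (simp add: maximal_ideal_def algebra_simps)
  qed
  define V where "V D = coeffs.span (bounded_monomials D :: 'n cpoly set)" for D
  \<comment> \<open>Uncountably many \<open>q c\<close> are distributed over countably many finite-dimensional spaces.\<close>
  have "\<exists>D. infinite {c. q c \<in> V D}"
  proof (rule ccontr)
    assume "\<not> ?thesis"
    then have "countable (\<Union>D. {c. q c \<in> V D})" by (auto intro: countable_finite)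
    moreover have "(\<Union>D. {c. q c \<in> V D}) = UNIV"
      using in_some_span_bounded_monomials unfolding V_def by blast
    ultimately show False using uncountable_UNIV_complex by simp
  qed
  then obtain D where "infinite {c. q c \<in> V D}" by blast
  then obtain Cs where Cs: "Cs \<subseteq> {c. q c \<in> V D}" "finite Cs"
      "card Cs = Suc (card (bounded_monomials D :: 'n cpoly set))"
    using infinite_arbitrarily_large by blast
  have "card (q ` Cs) = card Cs" using injq by (meson card_image inj_on_subset subset_UNIV)
  then have "coeffs.dependent (q ` Cs)"
    using coeffs.independent_span_bound[of "bounded_monomials D" "q ` Cs"] Cs unfolding V_def by fastforce
  then obtain u where u: "\<exists>v\<in>q ` Cs. u v \<noteq> 0" "(\<Sum>v\<in>q ` Cs. Const (u v) * v) = 0"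
    using coeffs.dependent_finite[of "q ` Cs"] Cs(2) by auto
  define a where "a c = u (q c)" for c
  obtain k0 where k0: "k0 \<in> Cs" "a k0 \<noteq> 0" using u(1) by (auto simp: a_def)
  have dep: "(\<Sum>c\<in>Cs. Const (a c) * q c) = 0"
    using u(2) inj_on_subset[OF injq subset_UNIV, of Cs] by (simp add: sum.reindex a_def)
  \<comment> \<open>The numerator of the dependence \<open>\<Sum>\<^sub>k a\<^sub>k / (X - k)\<close>; at \<open>k0\<close> only one summand survives.\<close>
  define p where "p = (\<Sum>k\<in>Cs. smult (a k) (\<Prod>l\<in>Cs - {k}. [:- l, 1:]))"
  have "poly p k0 = (\<Sum>k\<in>Cs. a k * (\<Prod>l\<in>Cs - {k}. k0 - l))"
    by (simp add: p_def poly_sum poly_prod)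
  also have "\<dots> = (\<Sum>k\<in>Cs. if k = k0 then a k0 * (\<Prod>l\<in>Cs - {k0}. k0 - l) else 0)"
  proof (rule sum.cong[OF refl])
    fix k assume "k \<in> Cs"
    then show "a k * (\<Prod>l\<in>Cs - {k}. k0 - l) = (if k = k0 then a k0 * (\<Prod>l\<in>Cs - {k0}. k0 - l) else 0)"
      using Cs(2) k0(1) by (auto simp: prod_zero_iff)
  qed
  also have "\<dots> = a k0 * (\<Prod>l\<in>Cs - {k0}. k0 - l)" using Cs(2) k0(1) by simp
  also have "\<dots> \<noteq> 0" using k0 Cs(2) by (simp add: prod_zero_iff)
  finally have "p \<noteq> 0" by auto
  define R where "R k = (\<Prod>l\<in>Cs - {k}. X - Const l)" for k
  have evp: "subst_poly p X = (\<Sum>k\<in>Cs. Const (a k) * R k)"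
    by (simp add: p_def R_def subst_poly_sum subst_poly_smult subst_poly_prod Const_uminus)
  have "(\<Sum>k\<in>Cs. Const (a k) * R k * (q k * (X - Const k) - 1)) \<in> M"
    by (intro ideal.subspace_sum[OF sM] ideal.subspace_scale[OF sM] q)
  moreover have "(\<Sum>k\<in>Cs. Const (a k) * R k * (q k * (X - Const k) - 1))
      = (\<Sum>k\<in>Cs. Const (a k) * q k * (\<Prod>l\<in>Cs. X - Const l)) - subst_poly p X"
    unfolding evp sum_subtractf[symmetric]
  proof (rule sum.cong[OF refl])
    fix k assume "k \<in> Cs"
    then have eq: "(\<Prod>l\<in>Cs. X - Const l) = (X - Const k) * R k"
      unfolding R_def using Cs(2) by (simp add: prod.remove)
    show "Const (a k) * R k * (q k * (X - Const k) - 1)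
        = Const (a k) * q k * (\<Prod>l\<in>Cs. X - Const l) - Const (a k) * R k"
      unfolding eq by (simp add: algebra_simps)
  qed
  moreover have "(\<Sum>k\<in>Cs. Const (a k) * q k * (\<Prod>l\<in>Cs. X - Const l)) = 0"
    using dep by (simp add: sum_distrib_right[symmetric])
  ultimately have "- subst_poly p X \<in> M" by simp
  then have "subst_poly p X \<in> M" using ideal.subspace_neg[OF sM] by fastforce
  then show False using maximal_ideal_algebraic[OF M \<open>p \<noteq> 0\<close>] \<open>\<nexists>c. X - Const c \<in> M\<close> by blast
qed

text \<open>
  The residues of the variables are the coordinates of the point \<open>x\<close>. Congruence to the value at
  \<open>x\<close> passes to sums and products, so it holds for all polynomials, and members of \<open>M\<close> have
  residue \<open>0\<close>.
\<close>

lemma maximal_ideal_vanishes: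
  fixes M :: "'n::finite cpoly set"
  assumes M: "maximal_ideal M"
  obtains x where "\<And>p. p \<in> M \<Longrightarrow> peval p x = 0"
proof -
  note sM = maximal_ideal_subspace[OF M]
  have "\<forall>i. \<exists>c. Var i - Const c \<in> M" using maximal_ideal_residue_Const[OF M] by blast
  then obtain c where c: "\<And>i. Var i - Const (c i) \<in> M" by metis
  define x :: "complex ^ 'n" where "x = (\<chi> i. c i)"
  have mult: "p * q - Const (peval (p * q) x) \<in> M"
    if "p - Const (peval p x) \<in> M" "q - Const (peval q x) \<in> M" for p q
  proof -
    have "q * (p - Const (peval p x)) + Const (peval p x) * (q - Const (peval q x)) \<in> M"
      using that sM by (intro ideal.subspace_add ideal.subspace_scale)
    then show ?thesis by (simp add: algebra_simps peval_mult Const_mult)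
  qed
  have pow: "Var i ^ k - Const (peval (Var i ^ k) x) \<in> M" for i :: 'n and k
  proof (induction k)
    case 0
    then show ?case using ideal.subspace_0[OF sM] by simp
  next
    case (Suc k)
    then show ?case using mult[of "Var i" "Var i ^ k"] c by (simp add: x_def)
  qed
  have prod: "(\<Prod>i\<in>S. Var i ^ f i) - Const (peval (\<Prod>i\<in>S. Var i ^ f i) x) \<in> M"
    if "finite S" for S :: "'n set" and f
    using that
  proof induction
    case empty
    then show ?case using ideal.subspace_0[OF sM] by simp
  next
    case (insert i S)
    then show ?case using mult pow by simp
  qed
  have val: "p - Const (peval p x) \<in> M" for p
  proof (induction p rule: cpoly_induct)
    case (monomial m a)
    have "Const a - Const (peval (Const a) x) \<in> M" using ideal.subspace_0[OF sM] by simp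
    then show ?case unfolding single_eq_prod_Var[of m a] by (rule mult[OF _ prod]) simp
  next
    case (add p q)
    then have "(p - Const (peval p x)) + (q - Const (peval q x)) \<in> M"
      by (rule ideal.subspace_add[OF sM])
    then show ?case by (simp add: peval_add Const_add algebra_simps)
  qed
  show ?thesis
  proof (rule that, rule ccontr)
    fix p assume "p \<in> M" "peval p x \<noteq> 0"
    have "p - (p - Const (peval p x)) \<in> M"
      by (rule ideal.subspace_diff[OF sM \<open>p \<in> M\<close> val])
    then show False using Const_notin_maximal_ideal[OF M] \<open>peval p x \<noteq> 0\<close> by simp
  qed
qed

text \<open>A proper ideal lies in a maximal one, and that vanishes at a point.\<close>

theorem weak_nullstellensatz:
  fixes S :: "'n::finite cpoly set"
  assumes "\<And>x. \<exists>p\<in>S. peval p x \<noteq> 0"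
  shows "1 \<in> ideal.span S"
proof (rule ccontr)
  assume "1 \<notin> ideal.span S"
  then obtain M where M: "maximal_ideal M" "ideal.span S \<subseteq> M"
    using maximal_ideal_exists ideal.subspace_span by blast
  obtain x where "\<And>p. p \<in> M \<Longrightarrow> peval p x = 0" using maximal_ideal_vanishes[OF M(1)] by blast
  moreover obtain p where "p \<in> S" "peval p x \<noteq> 0" using assms by blast
  ultimately show False using M(2) ideal.span_base by blast
qed

section \<open>Common zeros of few forms\<close>

subsection \<open>Homogeneous components\<close>

abbreviation total_degree :: "('n::finite \<Rightarrow>\<^sub>0 nat) \<Rightarrow> nat" where
  "total_degree m \<equiv> (\<Sum>i\<in>UNIV. Poly_Mapping.lookup m i)"

definition hom_part :: "nat \<Rightarrow> 'n::finite cpoly \<Rightarrow> 'n cpoly" where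
  "hom_part k p = (\<Sum>m\<in>{m \<in> Poly_Mapping.keys p. total_degree m = k}.
     Poly_Mapping.single m (Poly_Mapping.lookup p m))"

lemma lookup_hom_part:
  "Poly_Mapping.lookup (hom_part k p) m = (if total_degree m = k then Poly_Mapping.lookup p m else 0)"
  by (auto simp: hom_part_def lookup_sum lookup_single when_def in_keys_iff)

lemma hom_part_add: "hom_part k (p + q) = hom_part k p + hom_part k q"
  by (rule poly_mapping_eqI) (simp add: lookup_hom_part lookup_add)

lemma hom_part_0 [simp]: "hom_part k 0 = 0"
  by (simp add: hom_part_def)

lemma hom_part_uminus: "hom_part k (- p) = - hom_part k p"
  by (rule poly_mapping_eqI) (simp add: lookup_hom_part)

lemma hom_part_diff: "hom_part k (p - q) = hom_part k p - hom_part k q"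
  using hom_part_add[of k p "- q"] by (simp add: hom_part_uminus)

lemma hom_part_sum: "hom_part k (\<Sum>i\<in>S. f i) = (\<Sum>i\<in>S. hom_part k (f i))"
  by (induction S rule: infinite_finite_induct) (simp_all add: hom_part_add)

lemma homogeneous_hom_part: "homogeneous k (hom_part k p)"
  by (auto simp: homogeneous_def in_keys_iff lookup_hom_part split: if_splits)

lemma hom_part_homogeneous:
  assumes "homogeneous d p"
  shows "hom_part k p = (if k = d then p else 0)"
proof (rule poly_mapping_eqI)
  fix m
  show "Poly_Mapping.lookup (hom_part k p) m = Poly_Mapping.lookup (if k = d then p else 0) m"
    using assms by (auto simp: lookup_hom_part homogeneous_def in_keys_iff)
qed

lemma hom_part_mult:
  assumes f: "homogeneous e f"
  shows "hom_part k (p * f) = (if e \<le> k then hom_part (k - e) p * f else 0)"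
proof (induction p rule: cpoly_induct)
  case (monomial m a)
  have m: "homogeneous (total_degree m) (Poly_Mapping.single m a)"
    by (rule homogeneous_single) simp
  show ?case
    by (auto simp: hom_part_homogeneous[OF m] hom_part_homogeneous[OF homogeneous_mult[OF m f]])
qed (simp add: hom_part_add distrib_right)

lemma hom_part_eventually_0:
  obtains K where "\<And>k. k \<ge> K \<Longrightarrow> hom_part k p = 0"
proof (rule that)
  fix k assume k: "k \<ge> Suc (\<Sum>m\<in>Poly_Mapping.keys p. total_degree m)"
  have "total_degree m \<le> (\<Sum>m\<in>Poly_Mapping.keys p. total_degree m)" if "m \<in> Poly_Mapping.keys p" for m
    using that by (intro member_le_sum) auto
  then show "hom_part k p = 0" using k unfolding hom_part_def by (intro sum.neutral) force
qed

lemma homogeneous_power: "homogeneous e f \<Longrightarrow> homogeneous (k * e) (f ^ k)"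
proof (induction k)
  case 0
  then show ?case using homogeneous_Const[of 1] by simp
next
  case (Suc k)
  then show ?case using homogeneous_mult[of e f "k * e" "f ^ k"] by simp
qed

lemma ideal_span_image:
  assumes "finite J" "p \<in> ideal.span (f ` J)"
  obtains g where "p = (\<Sum>j\<in>J. g j * f j)"
proof -
  let ?T = "range (\<lambda>g. \<Sum>j\<in>J. g j * f j)"
  have "ideal.subspace ?T"
  proof (rule ideal.subspaceI)
    show "0 \<in> ?T" by (rule range_eqI[of _ _ "\<lambda>_. 0"]) simp
  next
    fix x y assume "x \<in> ?T" "y \<in> ?T"
    then obtain g h where "x = (\<Sum>j\<in>J. g j * f j)" "y = (\<Sum>j\<in>J. h j * f j)" by blast
    then show "x + y \<in> ?T"
      by (intro range_eqI[of _ _ "\<lambda>j. g j + h j"]) (simp add: distrib_right sum.distrib)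
  next
    fix c x assume "x \<in> ?T"
    then obtain g where "x = (\<Sum>j\<in>J. g j * f j)" by blast
    then show "c * x \<in> ?T"
      by (intro range_eqI[of _ _ "\<lambda>j. c * g j"]) (simp add: sum_distrib_left mult.assoc)
  qed
  moreover have "f ` J \<subseteq> ?T"
  proof
    fix x assume "x \<in> f ` J"
    then obtain j where j: "j \<in> J" "x = f j" by blast
    then show "x \<in> ?T"
      using assms(1) by (intro range_eqI[of _ _ "\<lambda>k. if k = j then 1 else 0"])
        (simp add: if_distrib[of "\<lambda>a. a * _"] cong: if_cong)
  qed
  ultimately have "ideal.span (f ` J) \<subseteq> ?T" by (intro ideal.span_minimal)
  then show ?thesis using assms(2) that by blast
qed

text \<open>
  A common zero of the forms \<open>f j\<close> is the origin, where \<open>x\<^sub>i - 1\<close> does not vanish. By the weak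
  Nullstellensatz this gives \<open>1 + g - g x\<^sub>i \<in> (f j)\<^sub>j\<close> for some \<open>g\<close>,
  and its homogeneous components say that the components of \<open>g\<close> are congruent to \<open>- x\<^sub>i\<^sup>k\<close>. As \<open>g\<close> is a
  polynomial, its components of large degree vanish.
\<close>

lemma Var_power_in_homogeneous_ideal:
  fixes f :: "'j \<Rightarrow> 'n::finite cpoly"
  assumes J: "finite J" and hom: "\<And>j. j \<in> J \<Longrightarrow> homogeneous (e j) (f j)"
    and nz: "\<And>x. (\<And>j. j \<in> J \<Longrightarrow> peval (f j) x = 0) \<Longrightarrow> x = 0"
  obtains K where "\<And>k. k \<ge> K \<Longrightarrow> Var i ^ k \<in> ideal.span (f ` J)"
proof -
  let ?I = "ideal.span (f ` J)"
  \<comment> \<open>An ideal generated by forms is homogeneous.\<close>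
  have hI: "hom_part k p \<in> ?I" if p: "p \<in> ?I" for k p
  proof -
    obtain g where g: "p = (\<Sum>j\<in>J. g j * f j)" using ideal_span_image[OF J p] .
    show ?thesis unfolding g hom_part_sum
    proof (rule ideal.span_sum)
      fix j assume j: "j \<in> J"
      then show "hom_part k (g j * f j) \<in> ?I"
        unfolding hom_part_mult[OF hom[OF j]]
        by (auto intro: ideal.span_scale[OF ideal.span_base] ideal.span_zero)
    qed
  qed
  have "1 \<in> ideal.span (insert (Var i - 1) (f ` J))"
  proof (rule weak_nullstellensatz, rule ccontr)
    fix x :: "complex ^ 'n"
    assume "\<not> (\<exists>p\<in>insert (Var i - 1) (f ` J). peval p x \<noteq> 0)"
    then have "x $ i = 1" "\<And>j. j \<in> J \<Longrightarrow> peval (f j) x = 0" by (auto simp: peval_diff)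
    then show False using nz[of x] by simp
  qed
  then obtain g where "1 - g * (Var i - 1) \<in> ?I" by (auto simp: ideal.span_insert)
  then have u: "1 + g - g * Var i \<in> ?I" by (simp add: algebra_simps)
  have hV: "homogeneous 1 (Var i)" by (rule homogeneous_Var)
  have h1: "hom_part k 1 = (if k = 0 then 1 else (0 :: 'n cpoly))" for k
    using hom_part_homogeneous[OF homogeneous_Const[of 1], of k] by (cases "k = 0") simp_all
  have rec: "hom_part k g + Var i ^ k \<in> ?I" for k
  proof (induction k)
    case 0
    show ?case using hI[OF u, of 0] by (simp add: hom_part_diff hom_part_add h1 hom_part_mult[OF hV] add.commute)
  next
    case (Suc k)
    have "hom_part (Suc k) g - hom_part k g * Var i \<in> ?I"
      using hI[OF u, of "Suc k"] by (simp add: hom_part_diff hom_part_add h1 hom_part_mult[OF hV])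
    then have "(hom_part (Suc k) g - hom_part k g * Var i) + Var i * (hom_part k g + Var i ^ k) \<in> ?I"
      by (intro ideal.span_add ideal.span_scale Suc.IH)
    then show ?case by (simp add: algebra_simps)
  qed
  obtain K where "\<And>k. k \<ge> K \<Longrightarrow> hom_part k g = 0" using hom_part_eventually_0 by blast
  then have "Var i ^ k \<in> ?I" if "k \<ge> K" for k using rec[of k] that by simp
  then show ?thesis using that by blast
qed

subsection \<open>Counting monomials\<close>

lemma independent_bounded_monomials:
  "coeffs.independent (bounded_monomials B :: 'n::finite cpoly set)"
proof
  assume "coeffs.dependent (bounded_monomials B :: 'n cpoly set)"
  then obtain u where u: "\<exists>v\<in>bounded_monomials B. u v \<noteq> 0"
      "(\<Sum>v\<in>bounded_monomials B. Const (u v) * v) = (0 :: 'n cpoly)"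
    by (auto dest!: iffD1[OF coeffs.dependent_finite[OF finite_bounded_monomials]])
  then obtain v where v: "v \<in> bounded_monomials B" "u v \<noteq> 0" by blast
  then obtain m where m: "v = Poly_Mapping.single m 1" by (auto simp: bounded_monomials_def)
  have "Poly_Mapping.lookup (\<Sum>v\<in>bounded_monomials B. Const (u v) * v) m
      = (\<Sum>w\<in>bounded_monomials B. if w = v then u v else 0)"
    unfolding lookup_sum lookup_Const_mult
    by (intro sum.cong refl) (auto simp: m bounded_monomials_def lookup_single when_def split: if_splits)
  also have "\<dots> = u v" using v by simp
  finally show False using u v by simp
qed

lemma card_bounded_monomials: "card (bounded_monomials B :: 'n::finite cpoly set) = B ^ CARD('n)"
  unfolding bounded_monomials_def
  by (subst card_image) (auto simp: card_bounded_exponents inj_on_def intro!: poly_mapping_eqI dest: arg_cong[where f = Poly_Mapping.keys])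

text \<open>
  A monomial divisible by the \<open>L\<close>-th power of a variable can be rewritten as a combination of the
  \<open>f j\<close> whose coefficients have smaller degree, because the \<open>f j\<close> are forms of positive degree.
  Repeating this leaves combinations of products of a monomial with exponents below \<open>L\<close> and of powers
  of the \<open>f j\<close>.
\<close>

lemma monomial_in_span_forms:
  fixes f :: "'j \<Rightarrow> 'n::finite cpoly"
  assumes J: "finite J" and e: "\<And>j. j \<in> J \<Longrightarrow> 1 \<le> e j \<and> e j \<le> L"
    and hom: "\<And>j. j \<in> J \<Longrightarrow> homogeneous (e j) (f j)"
    and L: "1 \<le> L" and pow: "\<And>i. Var i ^ L \<in> ideal.span (f ` J)"
  shows "total_degree m \<le> D \<Longrightarrow> Poly_Mapping.single m 1 \<in> coeffs.span
     ((\<lambda>(\<alpha>, \<beta>). Poly_Mapping.single \<alpha> 1 * (\<Prod>j\<in>J. f j ^ \<beta> j)) `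
       ({\<alpha>. \<forall>i. Poly_Mapping.lookup \<alpha> i < L} \<times> PiE J (\<lambda>_. {..D})))"
proof (induction D arbitrary: m)
  case 0
  then have "\<forall>i. Poly_Mapping.lookup m i < L" using L by (simp add: less_le_trans[of 0 1])
  then have "(m, \<lambda>j\<in>J. 0 :: nat) \<in> {\<alpha>. \<forall>i. Poly_Mapping.lookup \<alpha> i < L} \<times> PiE J (\<lambda>_. {..0})" by auto
  from coeffs.span_base[OF imageI[OF this, of "\<lambda>(\<alpha>, \<beta>). Poly_Mapping.single \<alpha> 1 * (\<Prod>j\<in>J. f j ^ \<beta> j)"]]
  show ?case by simp
next
  case (Suc D)
  let ?g = "\<lambda>(\<alpha>, \<beta>). Poly_Mapping.single \<alpha> 1 * (\<Prod>j\<in>J. f j ^ \<beta> j)"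
  let ?X = "\<lambda>D. {\<alpha> :: 'n \<Rightarrow>\<^sub>0 nat. \<forall>i. Poly_Mapping.lookup \<alpha> i < L} \<times> PiE J (\<lambda>_. {..D})"
  let ?W = "\<lambda>D. coeffs.span (?g ` ?X D)"
  show ?case
  proof (cases "\<forall>i. Poly_Mapping.lookup m i < L")
    case True
    then have "(m, \<lambda>j\<in>J. 0) \<in> ?X (Suc D)" by auto
    from coeffs.span_base[OF imageI[OF this, of ?g]] show ?thesis by simp
  next
    case False
    then obtain i where i: "L \<le> Poly_Mapping.lookup m i" by (auto simp: not_less)
    define m' where "m' = m - Poly_Mapping.single i L"
    have m: "m = m' + Poly_Mapping.single i L"
      unfolding m'_def using i
      by (intro poly_mapping_eqI) (auto simp: lookup_add lookup_minus lookup_single when_def)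
    have degm: "total_degree m = total_degree m' + L"
      unfolding m by (simp add: lookup_add sum.distrib lookup_single when_def)
    obtain h where h: "Var i ^ L = (\<Sum>j\<in>J. h j * f j)" using ideal_span_image[OF J pow] .
    have "Var i ^ L = hom_part L (Var i ^ L)"
      using hom_part_homogeneous[OF homogeneous_power[OF homogeneous_Var[of i], of L], of L] by simp
    also have "\<dots> = (\<Sum>j\<in>J. hom_part (L - e j) (h j) * f j)"
      unfolding h hom_part_sum using e by (intro sum.cong refl) (simp add: hom_part_mult[OF hom])
    finally have VL: "Var i ^ L = (\<Sum>j\<in>J. hom_part (L - e j) (h j) * f j)" .
    have "Poly_Mapping.single m 1 = Poly_Mapping.single m' 1 * Var i ^ L"
      by (simp add: m Var_power mult_single)
    also have "\<dots> = (\<Sum>j\<in>J. (Poly_Mapping.single m' 1 * hom_part (L - e j) (h j)) * f j)"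
      unfolding VL by (simp add: sum_distrib_left mult.assoc)
    also have "\<dots> \<in> ?W (Suc D)"
    proof (rule coeffs.span_sum)
      fix j assume j: "j \<in> J"
      let ?p = "Poly_Mapping.single m' 1 * hom_part (L - e j) (h j)"
      have hp: "homogeneous (total_degree m' + (L - e j)) ?p"
        by (intro homogeneous_mult homogeneous_single homogeneous_hom_part refl)
      have "total_degree m' + (L - e j) \<le> D" using degm Suc.prems conjunct1[OF e[OF j]] conjunct2[OF e[OF j]] by linarith
      then have "Poly_Mapping.single k 1 \<in> ?W D" if "k \<in> Poly_Mapping.keys ?p" for k
        using homogeneousD[OF hp that] by (intro Suc.IH) simp
      then have "(\<Sum>k\<in>Poly_Mapping.keys ?p. Const (Poly_Mapping.lookup ?p k) * Poly_Mapping.single k 1) \<in> ?W D"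
        by (intro coeffs.span_sum coeffs.span_scale)
      then have pW: "?p \<in> ?W D" by (simp add: Const_mult_single flip: cpoly_sum_monomials)
      have sub: "coeffs.subspace {q. q * f j \<in> ?W (Suc D)}"
      proof (rule coeffs.subspaceI)
        show "0 \<in> {q. q * f j \<in> ?W (Suc D)}" using coeffs.span_zero by simp
      next
        fix x y assume "x \<in> {q. q * f j \<in> ?W (Suc D)}" "y \<in> {q. q * f j \<in> ?W (Suc D)}"
        then show "x + y \<in> {q. q * f j \<in> ?W (Suc D)}"
          using coeffs.span_add[of "x * f j" "?g ` ?X (Suc D)" "y * f j"] by (simp add: distrib_right)
      next
        fix c x assume "x \<in> {q. q * f j \<in> ?W (Suc D)}"
        then show "Const c * x \<in> {q. q * f j \<in> ?W (Suc D)}"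
          using coeffs.span_scale[of "x * f j" "?g ` ?X (Suc D)" c] by (simp add: mult.assoc)
      qed
      have "?g ` ?X D \<subseteq> {q. q * f j \<in> ?W (Suc D)}"
      proof
        fix q assume "q \<in> ?g ` ?X D"
        then obtain \<alpha> \<beta> where q: "q = Poly_Mapping.single \<alpha> 1 * (\<Prod>k\<in>J. f k ^ \<beta> k)"
          and \<alpha>: "\<forall>i. Poly_Mapping.lookup \<alpha> i < L" and \<beta>: "\<beta> \<in> PiE J (\<lambda>_. {..D})" by auto
        have "(\<Prod>k\<in>J. f k ^ \<beta> k) * f j = (\<Prod>k\<in>J. f k ^ (\<beta>(j := Suc (\<beta> j))) k)"
          using J j by (simp add: prod.remove[of J j] mult_ac)
        then have qf: "q * f j = ?g (\<alpha>, \<beta>(j := Suc (\<beta> j)))" by (simp add: q mult.assoc)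
        have "(\<alpha>, \<beta>(j := Suc (\<beta> j))) \<in> ?X (Suc D)"
          using \<alpha> \<beta> j by (auto simp: PiE_iff extensional_def le_Suc_eq)
        then have "?g (\<alpha>, \<beta>(j := Suc (\<beta> j))) \<in> ?W (Suc D)" by (intro coeffs.span_base imageI)
        then show "q \<in> {q. q * f j \<in> ?W (Suc D)}" unfolding mem_Collect_eq qf .
      qed
      then have "?W D \<subseteq> {q. q * f j \<in> ?W (Suc D)}" using sub by (rule coeffs.span_minimal)
      then show "?p * f j \<in> ?W (Suc D)" using pW by blast
    qed
    finally show ?thesis .
  qed
qed

text \<open>
  If the origin were the only common zero, then the \<open>B\<^sup>n\<close> monomials with exponents below \<open>B\<close>, which are
  linearly independent, would all lie in a space whose dimension is at most a constant times
  \<open>B\<close> to the number of forms. As that number is less than \<open>n\<close>, this fails for large \<open>B\<close>.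
\<close>

theorem common_zero_of_few_forms:
  fixes f :: "'j \<Rightarrow> 'n::finite cpoly"
  assumes J: "finite J" "card J < CARD('n)"
    and e: "\<And>j. j \<in> J \<Longrightarrow> 1 \<le> e j" and hom: "\<And>j. j \<in> J \<Longrightarrow> homogeneous (e j) (f j)"
  obtains x where "x \<noteq> 0" "\<And>j. j \<in> J \<Longrightarrow> peval (f j) x = 0"
proof (rule ccontr)
  assume no: "\<not> thesis"
  then have nz: "\<And>x. (\<And>j. j \<in> J \<Longrightarrow> peval (f j) x = 0) \<Longrightarrow> x = 0" using that by blast
  have "\<forall>i. \<exists>K. \<forall>k\<ge>K. Var i ^ k \<in> ideal.span (f ` J)"
  proof
    fix i :: 'n
    obtain K where "\<And>k. k \<ge> K \<Longrightarrow> Var i ^ k \<in> ideal.span (f ` J)"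
      using Var_power_in_homogeneous_ideal[where e = e, OF J(1) hom nz] by blast
    then show "\<exists>K. \<forall>k\<ge>K. Var i ^ k \<in> ideal.span (f ` J)" by blast
  qed
  then obtain K where K: "\<And>i k. k \<ge> K i \<Longrightarrow> Var i ^ k \<in> ideal.span (f ` J)" by metis
  define L where "L = Suc ((\<Sum>i\<in>UNIV. K i) + (\<Sum>j\<in>J. e j))"
  have KL: "K i \<le> L" for i
    using member_le_sum[of i UNIV K] by (simp add: L_def)
  have eL: "e j \<le> L" if "j \<in> J" for j
    using member_le_sum[OF that, of e] J by (simp add: L_def)
  define n where "n = CARD('n)"
  \<comment> \<open>The space has dimension at most \<open>L\<^sup>n (n B + 1)\<^sup>c \<le> C B\<^sup>c\<close> with \<open>c = card J\<close>, so any \<open>B > C\<close> will do.\<close>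
  define C where "C = L ^ n * (n + 1) ^ card J"
  define B where "B = Suc C"
  define X where "X = {\<alpha> :: 'n \<Rightarrow>\<^sub>0 nat. \<forall>i. Poly_Mapping.lookup \<alpha> i < L} \<times> PiE J (\<lambda>_. {..n * B})"
  define T where "T = (\<lambda>(\<alpha>, \<beta>). Poly_Mapping.single \<alpha> 1 * (\<Prod>j\<in>J. f j ^ \<beta> j)) ` X"
  have finX: "finite X" unfolding X_def using J by (intro finite_cartesian_product card_bounded_exponents finite_PiE) auto
  have "bounded_monomials B \<subseteq> coeffs.span T"
  proof
    fix p :: "'n cpoly" assume "p \<in> bounded_monomials B"
    then obtain m where m: "p = Poly_Mapping.single m 1" "\<And>i. Poly_Mapping.lookup m i < B"
      by (auto simp: bounded_monomials_def)
    have "total_degree m \<le> n * B"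
      using sum_bounded_above[of UNIV "Poly_Mapping.lookup m" B] m(2) by (simp add: n_def less_imp_le)
    then show "p \<in> coeffs.span T" unfolding m(1) T_def X_def
      using J(1) e eL hom K[OF KL] by (intro monomial_in_span_forms[where e = e]) (auto simp: L_def)
  qed
  then have "card (bounded_monomials B :: 'n cpoly set) \<le> card T"
    using coeffs.independent_span_bound[OF _ independent_bounded_monomials] finX unfolding T_def by blast
  also have "\<dots> \<le> card X" unfolding T_def by (rule card_image_le[OF finX])
  also have "card X = L ^ n * (n * B + 1) ^ card J"
    unfolding X_def card_cartesian_product card_bounded_exponents using J by (simp add: card_PiE n_def)
  also have "\<dots> \<le> L ^ n * ((n + 1) * B) ^ card J"
    by (intro mult_left_mono power_mono) (auto simp: B_def)
  also have "\<dots> = C * B ^ card J" unfolding C_def by (simp only: power_mult_distrib mult.assoc)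
  also have "\<dots> \<le> C * B ^ (n - 1)"
    using J(2) by (intro mult_left_mono power_increasing) (auto simp: B_def n_def)
  also have "\<dots> < B * B ^ (n - 1)" by (simp add: B_def)
  also have "\<dots> = B ^ n" using J(2) by (simp add: n_def flip: power_Suc)
  finally show False by (simp add: card_bounded_monomials n_def)
qed

section \<open>Smooth hypersurfaces and transversal lines\<close>

subsection \<open>Restriction of a form to a line\<close>

lemma coeff_mult_bounded:
  fixes p q :: "'a::comm_semiring_0 poly"
  assumes "degree p \<le> m" "degree q \<le> n"
  shows "coeff (p * q) (m + n) = coeff p m * coeff q n"
proof -
  have "coeff (p * q) (m + n) = (\<Sum>i\<le>m + n. coeff p i * coeff q (m + n - i))"
    by (rule coeff_mult)
  also have "\<dots> = (\<Sum>i\<in>{m}. coeff p i * coeff q (m + n - i))"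
  proof (rule sum.mono_neutral_right)
    show "\<forall>i\<in>{..m + n} - {m}. coeff p i * coeff q (m + n - i) = 0"
    proof
      fix i assume "i \<in> {..m + n} - {m}"
      then have "i > m \<or> m + n - i > n" by auto
      then show "coeff p i * coeff q (m + n - i) = 0"
        using assms by (auto simp: coeff_eq_0)
    qed
  qed auto
  finally show ?thesis by simp
qed

lemma power_linear_poly_bounded:
  fixes a b :: complex
  shows "degree ([:a, b:] ^ k) \<le> k \<and> coeff ([:a, b:] ^ k) k = b ^ k"
proof (induction k)
  case (Suc k)
  have "degree [:a, b:] \<le> 1" by simp
  then have "degree ([:a, b:] * [:a, b:] ^ k) \<le> 1 + k"
    using Suc degree_mult_le[of "[:a, b:]" "[:a, b:] ^ k"] by linarith
  moreover have "coeff ([:a, b:] * [:a, b:] ^ k) (1 + k) = b * b ^ k"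
    using Suc coeff_mult_bounded[of "[:a, b:]" 1 "[:a, b:] ^ k" k] by simp
  ultimately show ?case by simp
qed simp

lemma prod_linear_poly_bounded:
  fixes a b :: "'i \<Rightarrow> complex"
  assumes "finite S"
  shows "degree (\<Prod>i\<in>S. [:a i, b i:] ^ f i) \<le> (\<Sum>i\<in>S. f i) \<and>
    coeff (\<Prod>i\<in>S. [:a i, b i:] ^ f i) (\<Sum>i\<in>S. f i) = (\<Prod>i\<in>S. b i ^ f i)"
  using assms
proof induction
  case (insert i S)
  let ?p = "[:a i, b i:] ^ f i" and ?q = "\<Prod>i\<in>S. [:a i, b i:] ^ f i"
  have p: "degree ?p \<le> f i" "coeff ?p (f i) = b i ^ f i" using power_linear_poly_bounded by blast+
  have "degree (?p * ?q) \<le> f i + (\<Sum>i\<in>S. f i)"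
    using insert.IH p degree_mult_le[of ?p ?q] by linarith
  moreover have "coeff (?p * ?q) (f i + (\<Sum>i\<in>S. f i)) = b i ^ f i * (\<Prod>i\<in>S. b i ^ f i)"
    using insert.IH p coeff_mult_bounded[of ?p "f i" ?q "\<Sum>i\<in>S. f i"] by simp
  ultimately show ?case using insert.hyps by simp
qed simp

definition line_poly :: "'n::finite cpoly \<Rightarrow> complex ^ 'n \<Rightarrow> complex ^ 'n \<Rightarrow> complex poly" where
  "line_poly F a b = (\<Sum>m\<in>Poly_Mapping.keys F. smult (Poly_Mapping.lookup F m)
     (\<Prod>i\<in>UNIV. [:a $ i, b $ i:] ^ Poly_Mapping.lookup m i))"

lemma poly_line_poly: "poly (line_poly F a b) t = peval F (a + t *s b)"
  by (simp add: line_poly_def peval_def poly_sum poly_prod algebra_simps)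

lemma degree_line_poly_le:
  assumes "homogeneous d F"
  shows "degree (line_poly F a b) \<le> d"
  unfolding line_poly_def
proof (rule degree_sum_le)
  fix m assume m: "m \<in> Poly_Mapping.keys F"
  show "degree (smult (Poly_Mapping.lookup F m) (\<Prod>i\<in>UNIV. [:a $ i, b $ i:] ^ Poly_Mapping.lookup m i)) \<le> d"
    using prod_linear_poly_bounded[of UNIV "($) a" "($) b" "Poly_Mapping.lookup m"] homogeneousD[OF assms m]
      degree_smult_le order_trans by fastforce
qed simp

lemma coeff_line_poly:
  assumes "homogeneous d F"
  shows "coeff (line_poly F a b) d = peval F b"
  unfolding line_poly_def peval_def coeff_sum coeff_smult
proof (intro sum.cong refl)
  fix m assume m: "m \<in> Poly_Mapping.keys F"
  show "Poly_Mapping.lookup F m * coeff (\<Prod>i\<in>UNIV. [:a $ i, b $ i:] ^ Poly_Mapping.lookup m i) d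
      = Poly_Mapping.lookup F m * (\<Prod>i\<in>UNIV. (b $ i) ^ Poly_Mapping.lookup m i)"
    using prod_linear_poly_bounded[of UNIV "($) a" "($) b" "Poly_Mapping.lookup m"] homogeneousD[OF assms m] by simp
qed

lemma degree_line_poly:
  assumes "homogeneous d F" "peval F b \<noteq> 0"
  shows "degree (line_poly F a b) = d" "lead_coeff (line_poly F a b) = peval F b"
    "line_poly F a b \<noteq> 0"
proof -
  show "degree (line_poly F a b) = d"
    using le_degree[of "line_poly F a b" d] degree_line_poly_le[OF assms(1), of a b]
      coeff_line_poly[OF assms(1), of a b] assms(2) by simp
  then show "lead_coeff (line_poly F a b) = peval F b"
    using coeff_line_poly[OF assms(1), of a b] by simp
  then show "line_poly F a b \<noteq> 0" using assms(2) by auto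
qed

lemma pderiv_line_poly:
  "poly (pderiv (line_poly F a b)) t = (\<Sum>i\<in>UNIV. b $ i * peval (partial_deriv i F) (a + t *s b))"
proof (rule DERIV_unique)
  show "(poly (line_poly F a b) has_field_derivative poly (pderiv (line_poly F a b)) t) (at t)"
    by (rule poly_DERIV)
  show "(poly (line_poly F a b) has_field_derivative
      (\<Sum>i\<in>UNIV. b $ i * peval (partial_deriv i F) (a + t *s b))) (at t)"
    using peval_has_derivative_line[of F a b t] by (simp add: poly_line_poly[abs_def])
qed

lemma isCont_line: "isCont (\<lambda>t. peval F (a + t *s b)) (t :: complex)"
  using peval_has_derivative_line DERIV_isCont by blast

subsection \<open>Roots of nearby polynomials\<close>

text \<open>
  The modulus of the value at \<open>t\<close> is that of the leading coefficient times the product of the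
  distances from \<open>t\<close> to the roots, so a small value forces a root nearby.
\<close>

lemma root_near_small_value:
  fixes q :: "complex poly"
  assumes "degree q = n" "c \<le> norm (lead_coeff q)" "0 < \<delta>" "norm (poly q t) < c * \<delta> ^ n"
  shows "\<exists>r. poly q r = 0 \<and> dist r t < \<delta>"
  using assms
proof (induction n arbitrary: q)
  case 0
  then obtain a where "q = [:a:]" by (metis degree_eq_zeroE)
  then show ?case using 0 by simp
next
  case (Suc n)
  then have "\<not> constant (poly q)" by (simp add: constant_degree)
  then obtain z where z: "poly q z = 0" using fundamental_theorem_of_algebra by blast
  then obtain p where p: "q = [:- z, 1:] * p" by (metis dvdE poly_eq_0_iff_dvd)
  show ?case
  proof (cases "dist z t < \<delta>")
    case True
    then show ?thesis using z by blast
  next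
    case False
    have "p \<noteq> 0" using p Suc.prems(1) by auto
    then have deg: "degree p = n" using Suc.prems(1) unfolding p by (simp add: degree_mult_eq del: mult_pCons_left)
    have "lead_coeff q = lead_coeff p" unfolding p lead_coeff_mult by simp
    moreover have "norm (poly p t) < c * \<delta> ^ n"
    proof -
      have "norm (poly q t) = dist z t * norm (poly p t)"
        unfolding p poly_mult by (simp add: norm_mult dist_norm norm_minus_commute)
      then have "\<delta> * norm (poly p t) \<le> norm (poly q t)" using False by (simp add: mult_right_mono)
      also have "\<dots> < \<delta> * (c * \<delta> ^ n)" using Suc.prems(4) by (simp add: mult_ac)
      finally show ?thesis using Suc.prems(3) by simp
    qed
    ultimately obtain r where "poly p r = 0" "dist r t < \<delta>"
      using Suc.IH[OF deg] Suc.prems by metis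
    then show ?thesis unfolding p by auto
  qed
qed

lemma finite_separated:
  fixes T :: "'a::metric_space set"
  assumes "finite T"
  obtains \<delta> where "0 < \<delta>" "\<And>x y. x \<in> T \<Longrightarrow> y \<in> T \<Longrightarrow> x \<noteq> y \<Longrightarrow> 2 * \<delta> \<le> dist x y"
proof -
  have "\<exists>\<delta>>0. \<forall>x\<in>T. \<forall>y\<in>T. x \<noteq> y \<longrightarrow> \<delta> \<le> dist x y" using assms
  proof induction
    case (insert a T)
    obtain \<delta> where \<delta>: "0 < \<delta>" "\<forall>x\<in>T. \<forall>y\<in>T. x \<noteq> y \<longrightarrow> \<delta> \<le> dist x y" using insert.IH by blast
    obtain \<epsilon> where \<epsilon>: "0 < \<epsilon>" "\<forall>x\<in>T. x \<noteq> a \<longrightarrow> \<epsilon> \<le> dist a x"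
      using finite_set_avoid[OF insert.hyps(1)] by blast
    have "\<forall>x\<in>insert a T. \<forall>y\<in>insert a T. x \<noteq> y \<longrightarrow> min \<delta> \<epsilon> \<le> dist x y"
      using \<delta>(2) \<epsilon>(2) by (auto simp: dist_commute min_le_iff_disj)
    then show ?case using \<delta>(1) \<epsilon>(1) by (intro exI[of _ "min \<delta> \<epsilon>"]) simp
  qed (auto intro: exI[of _ 1])
  then obtain \<delta> where "0 < \<delta>" "\<forall>x\<in>T. \<forall>y\<in>T. x \<noteq> y \<longrightarrow> \<delta> \<le> dist x y" by blast
  then show ?thesis using that[of "\<delta> / 2"] by simp
qed

lemma inj_on_nearby_points:
  fixes r :: "'a::metric_space \<Rightarrow> 'a"
  assumes sep: "\<And>x y. x \<in> T \<Longrightarrow> y \<in> T \<Longrightarrow> x \<noteq> y \<Longrightarrow> 2 * \<delta> \<le> dist x y"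
    and near: "\<And>x. x \<in> T \<Longrightarrow> dist (r x) x < \<delta>"
  shows "inj_on r T"
proof (rule inj_onI, rule ccontr)
  fix x y assume xy: "x \<in> T" "y \<in> T" "r x = r y" "x \<noteq> y"
  have "dist x y \<le> dist (r x) x + dist (r y) y"
    using dist_triangle3[of x y "r x"] xy(3) by simp
  then show False using sep[OF xy(1,2,4)] near[OF xy(1)] near[OF xy(2)] by linarith
qed

lemma card_roots_rsquarefree:
  fixes p :: "complex poly"
  assumes "rsquarefree p"
  shows "card {t. poly p t = 0} = degree p"
proof -
  have "p \<noteq> 0" using assms by (simp add: rsquarefree_def)
  have "degree p = degree (smult (lead_coeff p) (\<Prod>z|poly p z = 0. [:- z, 1:]))"
    by (simp add: complex_poly_decompose_rsquarefree[OF assms])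
  also have "\<dots> = degree (\<Prod>z|poly p z = 0. [:- z, 1:])" using \<open>p \<noteq> 0\<close> by simp
  also have "\<dots> = (\<Sum>z|poly p z = 0. degree [:- z, 1:])" by (rule degree_prod_eq_sum_degree) simp
  finally show ?thesis by simp
qed

subsection \<open>Existence of a transversal line\<close>

lemma smooth_gradient_nonzero:
  assumes "smooth_poly F" "x \<noteq> 0"
  obtains i where "peval (partial_deriv i F) x \<noteq> 0"
  using assms unfolding smooth_poly_def by blast

lemma smooth_not_identically_zero:
  fixes F :: "'n::finite cpoly"
  assumes "smooth_poly F"
  obtains b where "peval F b \<noteq> 0"
proof (rule ccontr)
  assume no: "\<not> thesis"
  define x :: "complex ^ 'n" where "x = (\<chi> i. 1)"
  have "x \<noteq> 0" by (simp add: x_def vec_eq_iff)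
  then obtain i where i: "peval (partial_deriv i F) x \<noteq> 0" using smooth_gradient_nonzero[OF assms] by blast
  have "((\<lambda>t. peval F (x + t *s axis i 1)) has_field_derivative peval (partial_deriv i F) x) (at 0)"
    using peval_has_derivative_line[of F x "axis i 1" 0] by (simp add: axis_def if_distrib[of "\<lambda>a. a * _"] cong: if_cong)
  moreover have "(\<lambda>t. peval F (x + t *s axis i 1)) = (\<lambda>t. 0)" using no that by blast
  ultimately show False using i DERIV_unique DERIV_const by metis
qed

text \<open>
  Among the lines whose direction \<open>b\<close> is not a zero of \<open>F\<close>, one that meets the hypersurface \<open>F = 0\<close> in as
  many points as possible meets it in \<open>d\<close> points: if it touches the hypersurface at \<open>p\<close>, then a slight rotation
  about \<open>p\<close> makes the intersection at \<open>p\<close> transversal. The other intersection points survive the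
  rotation, and the second root at \<open>p\<close> becomes a further intersection point close to \<open>p\<close>.
\<close>

lemma transversal_line_exists:
  fixes F :: "'n::finite cpoly"
  assumes hom: "homogeneous d F" and sm: "smooth_poly F" and d: "d \<ge> 1" and n: "CARD('n) \<ge> 2"
  obtains p b where "peval F b \<noteq> 0" "card {t. peval F (p + t *s b) = 0} = d"
proof -
  define P where "P = (\<lambda>(p, b). p \<noteq> 0 \<and> peval F p = 0 \<and> peval F b \<noteq> 0)"
  define N where "N = (\<lambda>(p, b). card {t. peval F (p + t *s b) = 0})"
  have roots: "{t. peval F (p + t *s b) = 0} = {t. poly (line_poly F p b) t = 0}" for p b
    by (simp add: poly_line_poly)
  have fin: "finite {t. peval F (p + t *s b) = 0}" if "peval F b \<noteq> 0" for p b
    unfolding roots using degree_line_poly(3)[OF hom that] by (rule poly_roots_finite)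
  have N_le: "N pb \<le> d" if "P pb" for pb
    using that card_poly_roots_bound[of "line_poly F (fst pb) (snd pb)"] degree_line_poly[OF hom]
    by (auto simp: P_def N_def roots)
  have not_through_0: "p + t *s b \<noteq> 0" if "P (p, b)" for p b t
  proof
    assume "p + t *s b = 0"
    then have p: "p = (- t) *s b" by (simp add: eq_neg_iff_add_eq_0)
    then have "(- t) ^ d * peval F b = 0" using that peval_scale[OF hom, of "- t" b] by (simp add: P_def)
    then have "t = 0" using that by (auto simp: P_def)
    then show False using p that by (simp add: P_def)
  qed
  have "\<exists>pb. P pb"
  proof -
    obtain b where b: "peval F b \<noteq> 0" using smooth_not_identically_zero[OF sm] .
    have "\<exists>a. \<forall>t. a + t *s b \<noteq> 0"
    proof -
      obtain i j :: 'n where ij: "i \<noteq> j"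
        using n by (metis UNIV_I card_le_Suc0_iff_eq finite_class.finite_UNIV not_less_eq_eq numeral_2_eq_2)
      show ?thesis
      proof (cases "b $ i = 0")
        case True
        then show ?thesis by (intro exI[of _ "axis i 1"]) (auto simp: vec_eq_iff axis_def intro!: exI[of _ i])
      next
        case False
        have "axis j 1 + t *s b \<noteq> 0" for t
        proof
          assume "axis j 1 + t *s b = 0"
          then have "(axis j 1 + t *s b) $ i = 0" "(axis j 1 + t *s b) $ j = 0" by simp_all
          then show False using ij False by (simp add: axis_def)
        qed
        then show ?thesis by blast
      qed
    qed
    then obtain a where a: "\<And>t. a + t *s b \<noteq> 0" by blast
    have "\<not> constant (poly (line_poly F a b))"
      using degree_line_poly(1)[OF hom b, of a] d by (simp add: constant_degree)
    then obtain t where "poly (line_poly F a b) t = 0" using fundamental_theorem_of_algebra by blast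
    then have "P (a + t *s b, b)" using a b by (simp add: P_def poly_line_poly)
    then show ?thesis by blast
  qed
  moreover have "\<forall>pb. P pb \<longrightarrow> N pb < Suc d" using N_le by (simp add: less_Suc_eq_le)
  ultimately obtain pb where "P pb" and max: "\<forall>pb'. P pb' \<longrightarrow> N pb' \<le> N pb"
    using ex_has_greatest_nat[of P _ N "Suc d"] by blast
  obtain p b where pb: "pb = (p, b)" by (cases pb)
  have Fb: "peval F b \<noteq> 0" using \<open>P pb\<close> by (simp add: P_def pb)
  have "N pb = d"
  proof (rule ccontr)
    assume "N pb \<noteq> d"
    then have "\<not> rsquarefree (line_poly F p b)"
      using card_roots_rsquarefree degree_line_poly(1)[OF hom Fb] by (auto simp: N_def pb roots)
    then obtain t0 where t0: "poly (line_poly F p b) t0 = 0" "poly (pderiv (line_poly F p b)) t0 = 0"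
      unfolding rsquarefree_roots by blast
    \<comment> \<open>The base point is moved to the point of tangency.\<close>
    define p' where "p' = p + t0 *s b"
    have p'0: "p' \<noteq> 0" using not_through_0 \<open>P pb\<close> by (simp add: p'_def pb)
    have Fp': "peval F p' = 0" using t0 by (simp add: p'_def poly_line_poly)
    define D where "D w = (\<Sum>i\<in>UNIV. w $ i * peval (partial_deriv i F) p')" for w
    have Db: "D b = 0" using t0(2) by (simp add: pderiv_line_poly D_def p'_def)
    obtain i where i: "peval (partial_deriv i F) p' \<noteq> 0" using smooth_gradient_nonzero[OF sm p'0] .
    define v :: "complex ^ 'n" where "v = axis i 1"
    have Dv: "D v \<noteq> 0" using i by (simp add: D_def v_def axis_def if_distrib[of "\<lambda>a. a * _"] cong: if_cong)
    have Dlin: "D (b + \<epsilon> *s v) = \<epsilon> * D v" for \<epsilon>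
      using Db by (simp add: D_def algebra_simps sum.distrib sum_distrib_left)
    define S where "S = {t. peval F (p' + t *s b) = 0}"
    have finS: "finite S" unfolding S_def by (rule fin[OF Fb])
    have "0 \<in> S" using Fp' by (simp add: S_def)
    have "bij_betw (\<lambda>t. t + t0) S {t. peval F (p + t *s b) = 0}"
      by (rule bij_betwI[where g = "\<lambda>t. t - t0"]) (auto simp: S_def p'_def algebra_simps vec_eq_iff)
    then have cardS: "card S = N pb" by (simp add: N_def pb bij_betw_same_card)
    obtain \<delta> where \<delta>: "0 < \<delta>" and sep: "\<And>x y. x \<in> S \<Longrightarrow> y \<in> S \<Longrightarrow> x \<noteq> y \<Longrightarrow> 2 * \<delta> \<le> dist x y"
      using finite_separated[OF finS] by blast
    \<comment> \<open>The leading coefficient depends on the direction; \<open>c\<close> bounds it from below near \<open>b\<close>.\<close>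
    define c where "c = norm (peval F b) / 2"
    have c: "c > 0" using Fb by (simp add: c_def)
    have "\<forall>\<^sub>F \<epsilon> in at 0. c < norm (peval F (b + \<epsilon> *s v))"
    proof (rule order_tendstoD)
      show "((\<lambda>\<epsilon>. norm (peval F (b + \<epsilon> *s v))) \<longlongrightarrow> norm (peval F b)) (at 0)"
        using isCont_line[of 0 F b v] by (intro tendsto_norm) (simp add: isCont_def)
      show "c < norm (peval F b)" using c by (simp add: c_def)
    qed
    moreover have "\<forall>\<^sub>F \<epsilon> in at 0. norm (\<epsilon> * D v) < c * \<delta> ^ (d - 1)"
    proof (rule order_tendstoD)
      show "((\<lambda>\<epsilon>. norm (\<epsilon> * D v)) \<longlongrightarrow> 0) (at 0)" by (intro tendsto_eq_intros) auto
      show "0 < c * \<delta> ^ (d - 1)" using c \<delta> by simp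
    qed
    moreover have "\<forall>\<^sub>F \<epsilon> in at 0. \<forall>t\<in>S. norm (peval F (p' + t *s (b + \<epsilon> *s v))) < c * \<delta> ^ d"
    proof (rule eventually_ball_finite[OF finS], rule ballI)
      fix t assume t: "t \<in> S"
      show "\<forall>\<^sub>F \<epsilon> in at 0. norm (peval F (p' + t *s (b + \<epsilon> *s v))) < c * \<delta> ^ d"
      proof (rule order_tendstoD)
        have lim: "((\<lambda>\<epsilon>. norm (peval F ((p' + t *s b) + \<epsilon> *s (t *s v)))) \<longlongrightarrow> norm (peval F (p' + t *s b))) (at 0)"
          using isCont_line[of 0 F "p' + t *s b" "t *s v"] by (intro tendsto_norm) (simp add: isCont_def)
        have line: "(p' + t *s b) + \<epsilon> *s (t *s v) = p' + t *s (b + \<epsilon> *s v)" for \<epsilon>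
          by (simp add: vec_eq_iff algebra_simps)
        show "((\<lambda>\<epsilon>. norm (peval F (p' + t *s (b + \<epsilon> *s v)))) \<longlongrightarrow> 0) (at 0)"
          using lim[unfolded line] t by (simp add: S_def)
        show "0 < c * \<delta> ^ d" using c \<delta> by simp
      qed
    qed
    moreover have "\<forall>\<^sub>F \<epsilon> in at (0 :: complex). \<epsilon> \<noteq> 0" by (simp add: eventually_at_filter)
    ultimately have "\<forall>\<^sub>F \<epsilon> in at 0. c < norm (peval F (b + \<epsilon> *s v)) \<and> norm (\<epsilon> * D v) < c * \<delta> ^ (d - 1) \<and>
        (\<forall>t\<in>S. norm (peval F (p' + t *s (b + \<epsilon> *s v))) < c * \<delta> ^ d) \<and> \<epsilon> \<noteq> 0"
      by (simp add: eventually_conj_iff)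
    then obtain \<epsilon> where \<epsilon>: "c < norm (peval F (b + \<epsilon> *s v))" "norm (\<epsilon> * D v) < c * \<delta> ^ (d - 1)"
        "\<And>t. t \<in> S \<Longrightarrow> norm (peval F (p' + t *s (b + \<epsilon> *s v))) < c * \<delta> ^ d" "\<epsilon> \<noteq> 0"
      using eventually_happens'[OF at_neq_bot] by (metis (mono_tags, lifting))
    define b' where "b' = b + \<epsilon> *s v"
    have Fb': "peval F b' \<noteq> 0" using \<epsilon>(1) c by (auto simp: b'_def)
    define q where "q = line_poly F p' b'"
    have q0: "poly q 0 = 0" using Fp' by (simp add: q_def poly_line_poly)
    have q1: "poly (pderiv q) 0 = \<epsilon> * D v" using Dlin by (simp add: q_def pderiv_line_poly D_def b'_def)
    \<comment> \<open>The root \<open>0\<close> is split off; the small value \<open>\<epsilon> D v\<close> of the cofactor at \<open>0\<close> forces a second root nearby.\<close>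
    obtain s where s: "q = [:0, 1:] * s" using q0 by (metis dvdE minus_zero poly_eq_0_iff_dvd)
    have s0: "poly s 0 = \<epsilon> * D v" using q1 by (simp add: s pderiv_pCons)
    have degq: "degree q = d" "lead_coeff q = peval F b'" "q \<noteq> 0"
      using degree_line_poly[OF hom Fb'] by (simp_all add: q_def)
    have "s \<noteq> 0" using degq(3) s by auto
    then have degs: "degree s = d - 1" using degq(1) unfolding s by simp
    have lcs: "lead_coeff s = peval F b'" using degq(2) \<open>s \<noteq> 0\<close> unfolding s by simp
    have "\<exists>r. poly q r = 0 \<and> r \<noteq> 0 \<and> dist r t < \<delta>" if t: "t \<in> S" for t
    proof (cases "t = 0")
      case True
      have "\<exists>r. poly s r = 0 \<and> dist r 0 < \<delta>"
        using root_near_small_value[OF degs, of c \<delta> 0] \<epsilon>(1,2) \<delta> s0 lcs by (simp add: b'_def)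
      then obtain r where "poly s r = 0" "dist r 0 < \<delta>" by blast
      moreover have "r \<noteq> 0" using s0 \<epsilon>(4) Dv \<open>poly s r = 0\<close> by auto
      ultimately show ?thesis using True unfolding s by auto
    next
      case False
      have "\<exists>r. poly q r = 0 \<and> dist r t < \<delta>"
        using root_near_small_value[OF degq(1), of c \<delta> t] \<epsilon>(1) \<epsilon>(3)[OF t] \<delta> degq(2)
        by (simp add: b'_def q_def poly_line_poly)
      then obtain r where r: "poly q r = 0" "dist r t < \<delta>" by blast
      moreover have "r \<noteq> 0" using r(2) sep[OF \<open>0 \<in> S\<close> t] False \<delta> by auto
      ultimately show ?thesis by blast
    qed
    then obtain r where r: "\<And>t. t \<in> S \<Longrightarrow> poly q (r t) = 0 \<and> r t \<noteq> 0 \<and> dist (r t) t < \<delta>" by metis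
    have "inj_on r S" using sep r by (intro inj_on_nearby_points[where \<delta> = \<delta>]) auto
    then have "card (insert 0 (r ` S)) = Suc (N pb)"
      using r finS cardS by (subst card_insert_disjoint) (auto simp: card_image)
    moreover have "insert 0 (r ` S) \<subseteq> {t. peval F (p' + t *s b') = 0}"
      using r q0 by (auto simp: q_def poly_line_poly)
    ultimately have "Suc (N pb) \<le> N (p', b')"
      using card_mono[OF fin[OF Fb']] by (metis N_def case_prod_conv)
    moreover have "P (p', b')" using p'0 Fp' Fb' by (simp add: P_def)
    ultimately show False using max by fastforce
  qed
  then show ?thesis using that Fb by (simp add: N_def pb)
qed

text \<open>
  On a transversal line the restrictions of \<open>F\<close> and of \<open>F \<circ> A\<close> have the same \<open>d\<close> roots, so they are
  proportional. Lines close to a transversal line are transversal, and all of those with direction \<open>b\<close> have the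
  proportionality factor \<open>F (A b) / F b\<close>. So \<open>F \<circ> A\<close> and \<open>F\<close> are proportional on an open set,
  hence everywhere.
\<close>

lemma invariant_hypersurface_semi_invariant:
  fixes F :: "'n::finite cpoly" and A :: "complex ^ 'n ^ 'n"
  assumes hom: "homogeneous d F" and sm: "smooth_poly F" and d: "d \<ge> 1" and n: "CARD('n) \<ge> 2"
    and A: "invertible A" and inv: "\<And>x. peval F x = 0 \<Longrightarrow> peval F (A *v x) = 0"
  obtains c where "c \<noteq> 0" "\<And>x. peval F (A *v x) = c * peval F x"
proof -
  obtain p b where Fb: "peval F b \<noteq> 0" and card: "card {t. peval F (p + t *s b) = 0} = d"
    using transversal_line_exists[OF hom sm d n] .
  define S where "S = {t. peval F (p + t *s b) = 0}"
  have "finite S" using card d unfolding S_def by (metis card.infinite not_one_le_zero)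
  then obtain \<delta> where \<delta>: "0 < \<delta>" and sep: "\<And>x y. x \<in> S \<Longrightarrow> y \<in> S \<Longrightarrow> x \<noteq> y \<Longrightarrow> 2 * \<delta> \<le> dist x y"
    using finite_separated by blast
  define H where "H a = peval F (A *v a)" for a
  have Aline: "A *v (a + t *s b) = A *v a + t *s (A *v b)" for a b t
    by (simp add: matrix_vector_right_distrib vector_scalar_commute)
  have transversal: "peval F b * H a = H b * peval F a"
    if a: "\<And>t. t \<in> S \<Longrightarrow> norm (peval F (a + t *s b)) < norm (peval F b) * \<delta> ^ d" for a
  proof -
    let ?q = "line_poly F a b" and ?h = "line_poly F (A *v a) (A *v b)"
    have "\<exists>r. poly ?q r = 0 \<and> dist r t < \<delta>" if "t \<in> S" for t
      using root_near_small_value[OF degree_line_poly(1)[OF hom Fb], of "norm (peval F b)" a \<delta> t]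
        degree_line_poly(2)[OF hom Fb] \<delta> a[OF that] by (simp add: poly_line_poly)
    then obtain r where r: "\<And>t. t \<in> S \<Longrightarrow> poly ?q (r t) = 0 \<and> dist (r t) t < \<delta>" by metis
    have "inj_on r S" using sep r by (intro inj_on_nearby_points[where \<delta> = \<delta>]) auto
    then have cr: "card (r ` S) = d" using card by (simp add: card_image S_def)
    have "smult (peval F b) ?h = smult (H b) ?q"
    proof (rule poly_eqI_degree_lead_coeff)
      show "coeff (smult (peval F b) ?h) d = coeff (smult (H b) ?q) d"
        by (simp add: coeff_line_poly[OF hom] H_def)
      show "d \<le> card (r ` S)" using cr by simp
      show "degree (smult (peval F b) ?h) \<le> d" "degree (smult (H b) ?q) \<le> d"
        using degree_line_poly_le[OF hom] degree_smult_le order_trans by blast+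
      fix t assume "t \<in> r ` S"
      then have q: "poly ?q t = 0" using r by auto
      then have "poly ?h t = 0" using inv[of "a + t *s b"] by (simp add: poly_line_poly Aline)
      then show "poly (smult (peval F b) ?h) t = poly (smult (H b) ?q) t" using q by simp
    qed
    then have "poly (smult (peval F b) ?h) 0 = poly (smult (H b) ?q) 0" by simp
    then show ?thesis by (simp add: poly_line_poly H_def)
  qed
  have proportional: "peval F b * H x = H b * peval F x" for x
  proof -
    let ?g = "smult (peval F b) (line_poly F (A *v p) (A *v (x - p))) - smult (H b) (line_poly F p (x - p))"
    have g_eq: "poly ?g s = peval F b * H (p + s *s (x - p)) - H b * peval F (p + s *s (x - p))" for s
      by (simp only: poly_diff poly_smult poly_line_poly H_def Aline)
    have "\<forall>\<^sub>F s in at 0. \<forall>t\<in>S. norm (peval F ((p + s *s (x - p)) + t *s b)) < norm (peval F b) * \<delta> ^ d"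
    proof (rule eventually_ball_finite[OF \<open>finite S\<close>], rule ballI)
      fix t assume t: "t \<in> S"
      show "\<forall>\<^sub>F s in at 0. norm (peval F ((p + s *s (x - p)) + t *s b)) < norm (peval F b) * \<delta> ^ d"
      proof (rule order_tendstoD)
        have lim: "((\<lambda>s. norm (peval F ((p + t *s b) + s *s (x - p)))) \<longlongrightarrow> norm (peval F (p + t *s b))) (at 0)"
          using isCont_line[of 0 F "p + t *s b" "x - p"] by (intro tendsto_norm) (simp add: isCont_def)
        have line: "(p + t *s b) + s *s (x - p) = (p + s *s (x - p)) + t *s b" for s
          by (simp add: vec_eq_iff)
        show "((\<lambda>s. norm (peval F ((p + s *s (x - p)) + t *s b))) \<longlongrightarrow> 0) (at 0)"
          using lim[unfolded line] t by (simp add: S_def)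
        show "0 < norm (peval F b) * \<delta> ^ d" using Fb \<delta> by simp
      qed
    qed
    then have ev: "\<forall>\<^sub>F s in at 0. poly ?g s = 0"
    proof (rule eventually_mono)
      fix s assume "\<forall>t\<in>S. norm (peval F ((p + s *s (x - p)) + t *s b)) < norm (peval F b) * \<delta> ^ d"
      then show "poly ?g s = 0" unfolding g_eq using transversal[of "p + s *s (x - p)"] by simp
    qed
    have "?g = 0"
    proof (rule ccontr)
      assume "?g \<noteq> 0"
      then have "finite {s. poly ?g s = 0}" by (rule poly_roots_finite)
      then have "\<not> 0 islimpt {s. poly ?g s = 0}" by (rule islimpt_finite)
      then have "\<forall>\<^sub>F s in at 0. poly ?g s \<noteq> 0" by (simp add: islimpt_iff_eventually)
      with ev have "\<forall>\<^sub>F s in at (0 :: complex). False" by eventually_elim simp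
      then show False by simp
    qed
    then have "poly ?g 1 = 0" by simp
    then show ?thesis unfolding g_eq by simp
  qed
  show ?thesis
  proof (rule that[of "H b / peval F b"])
    show scaled: "peval F (A *v x) = H b / peval F b * peval F x" for x
      using proportional[of x] Fb by (simp add: H_def field_simps)
    obtain A' where "A ** A' = mat 1" using A by (auto simp: invertible_def)
    then have "A *v (A' *v b) = b" by (simp add: matrix_vector_mul_assoc)
    then show "H b / peval F b \<noteq> 0" using scaled[of "A' *v b"] Fb by auto
  qed
qed

section \<open>Simultaneous diagonalization\<close>

lemma primitive_root_of_unity:
  assumes "1 \<le> m"
  obtains w :: complex where "\<And>j. w ^ j = 1 \<longleftrightarrow> m dvd j"
proof (rule that)
  fix j
  show "exp (2 * of_real pi * \<i> / of_nat m) ^ j = (1 :: complex) \<longleftrightarrow> m dvd j"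
    using complex_root_unity_eq_1[OF assms, of j] by (simp add: exp_of_nat_mult[symmetric] mult_ac)
qed

text \<open>
  The components are the discrete Fourier coefficients
  \<open>y\<^sub>k = (1 / m) \<Sum>\<^sub>j w\<^sup>-\<^sup>j\<^sup>k A\<^sup>j x\<close>, where \<open>w\<close> is a primitive \<open>m\<close>-th root of unity. Being
  combinations of the \<open>A\<^sup>j x\<close>, they are eigenvectors of every matrix that commutes with \<open>A\<close> and has
  \<open>x\<close> as an eigenvector.
\<close>

lemma finite_order_eigenvector_decomposition:
  fixes A :: "complex ^ 'n ^ 'n" and x :: "complex ^ 'n"
  assumes m: "1 \<le> m" and per: "\<And>x. (((*v) A) ^^ m) x = x"
  obtains y where "x = (\<Sum>k<m. y k)" "\<And>k. \<exists>c. A *v y k = c *s y k"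
    "\<And>B c k. A ** B = B ** A \<Longrightarrow> B *v x = c *s x \<Longrightarrow> B *v y k = c *s y k"
proof -
  obtain w :: complex where w: "\<And>j. w ^ j = 1 \<longleftrightarrow> m dvd j" using primitive_root_of_unity[OF m] by blast
  have wm: "w ^ m = 1" and w0: "w \<noteq> 0" using w[of m] m by (auto simp: power_0_left)
  define f where "f j = (((*v) A) ^^ j) x" for j
  have fSuc: "f (Suc j) = A *v f j" for j by (simp add: f_def)
  have fm: "f m = f 0" using per[of x] by (simp add: f_def)
  define g where "g k j = inverse w ^ (k * j) *s f j" for k j
  define y where "y k = (1 / of_nat m :: complex) *s (\<Sum>j<m. g k j)" for k
  have Asum: "B *v (c *s (\<Sum>j<m. h j)) = c *s (\<Sum>j<m. B *v h j)" for c h and B :: "complex ^ 'n ^ 'n"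
  proof -
    have "B *v (\<Sum>j<l. h j) = (\<Sum>j<l. B *v h j)" for l
      by (induction l) (simp_all add: matrix_vector_right_distrib)
    then show ?thesis by (simp add: vector_scalar_commute)
  qed
  show ?thesis
  proof (rule that[of y])
    have geom: "(\<Sum>k<m. inverse w ^ (k * j)) = (if j = 0 then of_nat m else 0)" if "j < m" for j
    proof (cases "j = 0")
      case False
      define u where "u = inverse w ^ j"
      have "u \<noteq> 1" using w[of j] False that by (auto simp: u_def power_inverse dest: dvd_imp_le)
      moreover have "u ^ m = 1" using wm by (simp add: u_def power_inverse power_mult[symmetric] mult.commute[of j]) (simp add: power_mult)
      ultimately have "(\<Sum>k<m. u ^ k) = 0" by (simp add: geometric_sum)
      then show ?thesis using False by (simp add: u_def power_mult[symmetric] mult.commute)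
    qed simp
    have "(\<Sum>k<m. y k) = (1 / of_nat m :: complex) *s (\<Sum>k<m. \<Sum>j<m. g k j)"
      by (simp add: y_def vec_eq_iff sum_distrib_left)
    also have "(\<Sum>k<m. \<Sum>j<m. g k j) = (\<Sum>j<m. (\<Sum>k<m. inverse w ^ (k * j)) *s f j)"
      by (subst sum.swap) (simp add: g_def vec_eq_iff sum_distrib_right)
    also have "\<dots> = (\<Sum>j<m. if j = 0 then of_nat m *s f j else 0)"
      by (intro sum.cong refl) (simp add: geom)
    also have "\<dots> = of_nat m *s x" using m by (simp add: f_def)
    finally show "x = (\<Sum>k<m. y k)" using m by (simp add: vec_eq_iff)
  next
    fix k
    have "A *v y k = (1 / of_nat m) *s (\<Sum>j<m. A *v g k j)" unfolding y_def by (rule Asum)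
    also have "(\<Sum>j<m. A *v g k j) = (\<Sum>j<m. w ^ k *s g k (Suc j))"
      by (intro sum.cong refl)
        (simp add: g_def fSuc vector_scalar_commute power_add power_inverse w0)
    also have "\<dots> = w ^ k *s (\<Sum>j<m. g k (Suc j))" by (simp add: vec_eq_iff sum_distrib_left)
    also have "(\<Sum>j<m. g k (Suc j)) = (\<Sum>j<m. g k j)"
    proof -
      have "g k m = g k 0" by (simp add: g_def fm power_inverse mult.commute[of k] power_mult wm)
      then show ?thesis
        using sum.lessThan_Suc_shift[of "g k" m] sum.lessThan_Suc[of "g k" m] by simp
    qed
    finally have "A *v y k = w ^ k *s y k" by (simp add: y_def mult.commute)
    then show "\<exists>c. A *v y k = c *s y k" by blast
  next
    fix B c k assume AB: "A ** B = B ** A" and Bx: "B *v x = c *s x"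
    have Bf: "B *v f j = c *s f j" for j
    proof (induction j)
      case 0
      then show ?case using Bx by (simp add: f_def)
    next
      case (Suc j)
      have "B *v f (Suc j) = A *v (B *v f j)" by (simp add: fSuc matrix_vector_mul_assoc AB)
      then show ?case by (simp add: Suc fSuc vector_scalar_commute)
    qed
    have "B *v y k = (1 / of_nat m) *s (\<Sum>j<m. B *v g k j)" unfolding y_def by (rule Asum)
    also have "\<dots> = c *s y k"
      by (simp add: y_def g_def vector_scalar_commute Bf vec_eq_iff sum_distrib_left mult_ac)
    finally show "B *v y k = c *s y k" .
  qed
qed

lemma span_common_eigenvectors:
  fixes S :: "(complex ^ 'n ^ 'n) set"
  assumes "finite S" and m: "1 \<le> m" and per: "\<And>A x. A \<in> S \<Longrightarrow> (((*v) A) ^^ m) x = x"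
    and comm: "\<And>A B. A \<in> S \<Longrightarrow> B \<in> S \<Longrightarrow> A ** B = B ** A"
  shows "vec.span {x. \<forall>A\<in>S. \<exists>c. A *v x = c *s x} = UNIV"
proof -
  have "T \<subseteq> S \<Longrightarrow> vec.span {x. \<forall>A\<in>T. \<exists>c. A *v x = c *s x} = UNIV" if "finite T" for T
    using that
  proof induction
    case empty
    then show ?case by simp
  next
    case (insert A T)
    let ?E = "\<lambda>T. {x :: complex ^ 'n. \<forall>A\<in>T. \<exists>c. A *v x = c *s x}"
    have "?E T \<subseteq> vec.span (?E (insert A T))"
    proof
      fix x assume x: "x \<in> ?E T"
      obtain y where y: "x = (\<Sum>k<m. y k)" "\<And>k. \<exists>c. A *v y k = c *s y k"
        "\<And>B c k. A ** B = B ** A \<Longrightarrow> B *v x = c *s x \<Longrightarrow> B *v y k = c *s y k"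
        using finite_order_eigenvector_decomposition[of m A x] m per insert.prems by blast
      have "y k \<in> ?E (insert A T)" for k
      proof (rule CollectI, rule ballI)
        fix B assume B: "B \<in> insert A T"
        show "\<exists>c. B *v y k = c *s y k"
        proof (cases "B = A")
          case False
          then obtain c where "B *v x = c *s x" using B x by blast
          moreover have "A ** B = B ** A" using B insert.prems comm by blast
          ultimately show ?thesis using y(3) by blast
        qed (use y(2) in blast)
      qed
      then show "x \<in> vec.span (?E (insert A T))" unfolding y(1)
        by (intro vec.span_sum vec.span_base)
    qed
    then have "vec.span (?E T) \<subseteq> vec.span (?E (insert A T))" by (intro vec.span_minimal vec.subspace_span)
    then show ?case using insert by auto
  qed
  then show ?thesis using \<open>finite S\<close> by blast
qed

lemma simultaneous_diagonalization:
  fixes S :: "(complex ^ 'n ^ 'n) set"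
  assumes "finite S" and "1 \<le> m" and "\<And>A x. A \<in> S \<Longrightarrow> (((*v) A) ^^ m) x = x"
    and "\<And>A B. A \<in> S \<Longrightarrow> B \<in> S \<Longrightarrow> A ** B = B ** A"
  obtains P P' :: "complex ^ 'n ^ 'n" where "P ** P' = mat 1" "P' ** P = mat 1"
    "\<And>A i. A \<in> S \<Longrightarrow> \<exists>c. A *v column i P = c *s column i P"
proof -
  let ?E = "{x. \<forall>A\<in>S. \<exists>c. A *v x = c *s x}"
  obtain B where B: "B \<subseteq> ?E" "vec.independent B" "?E \<subseteq> vec.span B"
    using vec.maximal_independent_subset by blast
  have "vec.span ?E = UNIV" by (rule span_common_eigenvectors[OF assms])
  then have spB: "vec.span B = UNIV"
    using vec.span_minimal[OF B(3) vec.subspace_span] by auto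
  have "card B = vec.dim (UNIV :: (complex ^ 'n) set)"
    using vec.dim_eq_card_independent[OF B(2)] vec.dim_span[of B] spB by simp
  then have "card B = CARD('n)" by (simp add: vec.dim_UNIV card_cart_basis)
  moreover have "finite B" using vec.finiteI_independent[OF B(2)] .
  ultimately obtain e where e: "bij_betw e (UNIV :: 'n set) B"
    using finite_same_card_bij[of "UNIV :: 'n set" B] by auto
  define P :: "complex ^ 'n ^ 'n" where "P = (\<chi> i j. e j $ i)"
  have col: "column j P = e j" for j by (simp add: P_def column_def vec_eq_iff)
  have "columns P = B" using e by (auto simp: columns_def col bij_betw_def)
  then obtain P' where P': "P ** P' = mat 1"
    using matrix_right_invertible_span_columns[of P] spB by auto
  show ?thesis
  proof (rule that[OF P'])
    show "P' ** P = mat 1" using P' matrix_left_right_inverse by blast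
    show "\<exists>c. A *v column i P = c *s column i P" if "A \<in> S" for A i
      using e B(1) that unfolding col bij_betw_def by blast
  qed
qed

section \<open>The permutation of the characters\<close>

lemma roots_of_unity_power_inj:
  fixes a b :: "'a::field"
  assumes "a ^ m = 1" "b ^ m = 1" "coprime m e" "a ^ e = b ^ e" "1 \<le> m"
  shows "a = b"
proof (cases "m = 1")
  case True
  then show ?thesis using assms by simp
next
  case False
  have b0: "b \<noteq> 0" using assms(2,5) by (auto simp: power_0_left)
  define r where "r = a / b"
  have r: "r ^ m = 1" "r ^ e = 1" using assms b0 by (simp_all add: r_def power_divide)
  obtain x y where "e * x = m * y + 1"
    using coprime_bezout_strong[of e m] assms(3) False by (auto simp: coprime_commute)
  then have "(r ^ e) ^ x = (r ^ m) ^ y * r" by (simp add: power_mult[symmetric])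
  then have "r = 1" using r by simp
  then show ?thesis using b0 by (simp add: r_def)
qed

definition directional_deriv :: "complex ^ 'n \<Rightarrow> 'n::finite cpoly \<Rightarrow> 'n cpoly" where
  "directional_deriv w F = (\<Sum>j\<in>UNIV. Const (w $ j) * partial_deriv j F)"

lemma peval_directional_deriv:
  "peval (directional_deriv w F) x = (\<Sum>j\<in>UNIV. w $ j * peval (partial_deriv j F) x)"
  by (simp add: directional_deriv_def peval_sum peval_mult)

lemma homogeneous_directional_deriv:
  "homogeneous d F \<Longrightarrow> homogeneous (d - 1) (directional_deriv w F)"
  unfolding directional_deriv_def
  by (intro homogeneous_sum homogeneous_Const_mult homogeneous_partial_deriv)

lemma peval_directional_deriv_scale:
  "peval (directional_deriv (c *s w) F) x = c * peval (directional_deriv w F) x"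
  by (simp add: peval_directional_deriv sum_distrib_left mult.assoc)

lemma peval_directional_deriv_sum:
  "peval (directional_deriv (\<Sum>k\<in>S. c k *s w k) F) x = (\<Sum>k\<in>S. c k * peval (directional_deriv (w k) F) x)"
  unfolding peval_directional_deriv sum_distrib_left
  by (subst sum.swap) (simp add: sum_distrib_right mult.assoc)

text \<open>Both sides are the derivative at \<open>t = 0\<close> of \<open>F (A (x + t w)) = c F (x + t w)\<close>.\<close>

lemma directional_deriv_semi_invariant:
  fixes F :: "'n::finite cpoly" and A :: "complex ^ 'n ^ 'n"
  assumes "\<And>x. peval F (A *v x) = c * peval F x"
  shows "peval (directional_deriv (A *v w) F) (A *v x) = c * peval (directional_deriv w F) x"
proof (rule DERIV_unique)
  show "((\<lambda>t. peval F (A *v x + t *s (A *v w))) has_field_derivative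
      peval (directional_deriv (A *v w) F) (A *v x)) (at 0)"
    using peval_has_derivative_line[of F "A *v x" "A *v w" 0] by (simp add: peval_directional_deriv)
  have "(\<lambda>t. peval F (A *v x + t *s (A *v w))) = (\<lambda>t. c * peval F (x + t *s w))"
    by (simp add: assms[symmetric] matrix_vector_right_distrib vector_scalar_commute)
  moreover have "((\<lambda>t. peval F (x + t *s w)) has_field_derivative peval (directional_deriv w F) x) (at 0)"
    using peval_has_derivative_line[of F x w 0] by (simp add: peval_directional_deriv)
  ultimately show "((\<lambda>t. peval F (A *v x + t *s (A *v w))) has_field_derivative
      c * peval (directional_deriv w F) x) (at 0)"
    by (simp add: DERIV_cmult)
qed

definition row_form :: "complex ^ 'n \<Rightarrow> 'n::finite cpoly" where
  "row_form r = (\<Sum>j\<in>UNIV. Const (r $ j) * Var j)"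

lemma homogeneous_row_form: "homogeneous 1 (row_form r)"
  unfolding row_form_def by (intro homogeneous_sum homogeneous_Const_mult homogeneous_Var)

lemma peval_row_form: "peval (row_form (A $ i)) x = (A *v x) $ i"
  by (simp add: row_form_def peval_sum peval_mult matrix_vector_mult_def)

lemma matrix_vector_mult_columns:
  fixes P :: "complex ^ 'n ^ 'm"
  shows "P *v y = (\<Sum>k\<in>UNIV. y $ k *s column k P)"
  by (simp add: vec_eq_iff matrix_vector_mult_def column_def mult.commute)

text \<open>
  Let the columns \<open>b\<^sub>k\<close> of \<open>P\<close> be a basis of common eigenvectors with characters \<open>\<psi>\<^sub>k\<close>, and let \<open>F\<close> be
  semi-invariant with character \<open>\<kappa>\<close>. On the eigenspace \<open>W\<close> of \<open>\<psi>\<^sub>i\<close> the derivative of \<open>F\<close> in the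
  direction \<open>b\<^sub>k\<close> can only be nonzero if \<open>\<psi>\<^sub>i\<^sup>d\<^sup>-\<^sup>1 \<psi>\<^sub>k = \<kappa>\<close>. If there were fewer such \<open>k\<close> than \<open>dim W\<close>,
  then these derivatives, being forms, would have a common nontrivial zero on \<open>W\<close>, and \<open>F\<close> would be
  singular there.
\<close>

lemma card_character_class_le:
  fixes F :: "'n::finite cpoly" and P P' :: "complex ^ 'n ^ 'n"
  assumes d: "2 \<le> d" and hom: "homogeneous d F" and sm: "smooth_poly F"
    and P: "P ** P' = mat 1" "P' ** P = mat 1"
    and eig: "\<And>g k. g \<in> G \<Longrightarrow> \<sigma> g *v column k P = \<psi> g k *s column k P"
    and semi: "\<And>g x. g \<in> G \<Longrightarrow> peval F (\<sigma> g *v x) = \<kappa> g * peval F x"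
  shows "card {k. \<forall>g\<in>G. \<psi> g k = \<psi> g i} \<le> card {k. \<forall>g\<in>G. \<psi> g i ^ (d - 1) * \<psi> g k = \<kappa> g}"
    (is "card ?C \<le> card ?D")
proof (rule ccontr)
  assume "\<not> ?thesis"
  then have less: "card ?D < card ?C" by simp
  \<comment> \<open>The forms are the possibly nonzero derivatives and the coordinate functions that cut out \<open>W\<close>.\<close>
  define J where "J = ?D <+> (- ?C)"
  define f where "f = case_sum (\<lambda>k. directional_deriv (column k P) F) (\<lambda>k. row_form (P' $ k))"
  define e where "e = case_sum (\<lambda>_ :: 'n. d - 1) (\<lambda>_ :: 'n. 1)"
  have "card J = card ?D + (CARD('n) - card ?C)" unfolding J_def by (simp add: card_Plus Compl_eq_Diff_UNIV card_Diff_subset)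
  also have "\<dots> < CARD('n)" using less card_mono[of UNIV ?C] by simp
  finally have "card J < CARD('n)" .
  moreover have finJ: "finite J" by (simp add: J_def)
  moreover have "1 \<le> e j" "homogeneous (e j) (f j)" for j
    using d homogeneous_directional_deriv[OF hom] homogeneous_row_form
    by (auto simp: e_def f_def split: sum.split)
  ultimately obtain x where x: "x \<noteq> 0" "\<And>j. j \<in> J \<Longrightarrow> peval (f j) x = 0"
    using common_zero_of_few_forms[of J e f] finJ by blast
  define y where "y = P' *v x"
  have y0: "y $ k = 0" if "k \<notin> ?C" for k
    using x(2)[of "Inr k"] that by (simp add: J_def f_def peval_row_form y_def InrI)
  have xy: "x = P *v y" by (simp add: y_def matrix_vector_mul_assoc P)
  have sx: "\<sigma> g *v x = \<psi> g i *s x" if g: "g \<in> G" for g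
  proof -
    have "\<sigma> g *v x = (\<Sum>k\<in>UNIV. y $ k *s (\<sigma> g *v column k P))"
      unfolding xy matrix_vector_mult_columns[of P]
      by (simp add: matrix_vector_mult_def vec_eq_iff sum_distrib_left mult_ac) (subst sum.swap, simp)
    also have "\<dots> = (\<Sum>k\<in>UNIV. y $ k *s (\<psi> g i *s column k P))"
    proof (intro sum.cong refl)
      fix k
      show "y $ k *s (\<sigma> g *v column k P) = y $ k *s (\<psi> g i *s column k P)"
        using y0[of k] eig[OF g, of k] g by (cases "k \<in> ?C") auto
    qed
    also have "\<dots> = \<psi> g i *s x"
      unfolding xy matrix_vector_mult_columns[of P] by (simp add: vec_eq_iff sum_distrib_left mult_ac)
    finally show ?thesis .
  qed
  have D0: "peval (directional_deriv (column k P) F) x = 0" for k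
  proof (cases "k \<in> ?D")
    case True
    then show ?thesis using x(2)[of "Inl k"] by (simp add: J_def f_def InlI)
  next
    case False
    then obtain g where g: "g \<in> G" "\<psi> g i ^ (d - 1) * \<psi> g k \<noteq> \<kappa> g" by blast
    have "\<kappa> g * peval (directional_deriv (column k P) F) x
        = peval (directional_deriv (\<sigma> g *v column k P) F) (\<sigma> g *v x)"
      by (rule directional_deriv_semi_invariant[OF semi[OF g(1)], symmetric])
    also have "\<dots> = \<psi> g i ^ (d - 1) * \<psi> g k * peval (directional_deriv (column k P) F) x"
      by (simp add: eig[OF g(1)] sx[OF g(1)] peval_directional_deriv_scale
          peval_scale[OF homogeneous_directional_deriv[OF hom]])
    finally show ?thesis using g(2) by simp
  qed
  obtain l where l: "peval (partial_deriv l F) x \<noteq> 0" using smooth_gradient_nonzero[OF sm x(1)] .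
  have "axis l 1 = P *v (P' *v axis l 1)" by (simp add: matrix_vector_mul_assoc P)
  also have "\<dots> = (\<Sum>k\<in>UNIV. (P' *v axis l 1) $ k *s column k P)" by (rule matrix_vector_mult_columns)
  finally have ax: "axis l 1 = (\<Sum>k\<in>UNIV. (P' *v axis l 1) $ k *s column k P)" .
  have "peval (partial_deriv l F) x = peval (directional_deriv (axis l 1) F) x"
    by (simp add: peval_directional_deriv axis_def if_distrib[of "\<lambda>a. a * _"] cong: if_cong)
  also have "\<dots> = (\<Sum>k\<in>UNIV. (P' *v axis l 1) $ k * peval (directional_deriv (column k P) F) x)"
    by (subst ax) (rule peval_directional_deriv_sum)
  also have "\<dots> = 0" by (simp add: D0)
  finally show False using l by simp
qed

text \<open>
  By coprimality, \<open>\<alpha> \<mapsto> \<kappa> / \<alpha>\<^sup>d\<^sup>-\<^sup>1\<close> is injective on characters. Mapping the indices of each character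
  injectively to indices of its image therefore gives a permutation of all indices.
\<close>

lemma character_permutation:
  fixes F :: "'n::finite cpoly" and P P' :: "complex ^ 'n ^ 'n"
  assumes d: "2 \<le> d" and hom: "homogeneous d F" and sm: "smooth_poly F"
    and P: "P ** P' = mat 1" "P' ** P = mat 1"
    and eig: "\<And>g k. g \<in> G \<Longrightarrow> \<sigma> g *v column k P = \<psi> g k *s column k P"
    and semi: "\<And>g x. g \<in> G \<Longrightarrow> peval F (\<sigma> g *v x) = \<kappa> g * peval F x"
    and m: "1 \<le> m" "coprime m (d - 1)" and root: "\<And>g k. g \<in> G \<Longrightarrow> \<psi> g k ^ m = 1"
  obtains \<pi> where "bij \<pi>" "\<And>g i. g \<in> G \<Longrightarrow> \<psi> g i ^ (d - 1) * \<psi> g (\<pi> i) = \<kappa> g"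
proof -
  define C where "C i = {k. \<forall>g\<in>G. \<psi> g k = \<psi> g i}" for i
  define D where "D i = {k. \<forall>g\<in>G. \<psi> g i ^ (d - 1) * \<psi> g k = \<kappa> g}" for i
  have D_cong: "D i = D j" if "C i = C j" for i j
  proof -
    have "i \<in> C j" using that by (auto simp: C_def)
    then show ?thesis by (auto simp: C_def D_def)
  qed
  have "card (C i) \<le> card (D i)" for i
    unfolding C_def D_def by (rule card_character_class_le[OF d hom sm P eig semi])
  then have "\<exists>h. h ` C i \<subseteq> D i \<and> inj_on h (C i)" for i
    by (intro card_le_inj) simp_all
  then have "\<exists>h. \<forall>i. X = C i \<longrightarrow> h ` X \<subseteq> D i \<and> inj_on h X" for X
    by (cases "\<exists>i. X = C i") (auto, metis D_cong)
  then obtain h where h: "\<And>i. h (C i) ` C i \<subseteq> D i \<and> inj_on (h (C i)) (C i)" by metis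
  define \<pi> where "\<pi> i = h (C i) i" for i
  have mem: "i \<in> C i" for i by (simp add: C_def)
  have \<pi>: "\<psi> g i ^ (d - 1) * \<psi> g (\<pi> i) = \<kappa> g" if "g \<in> G" for g i
    using h[of i] mem[of i] that by (auto simp: \<pi>_def D_def)
  have "inj \<pi>"
  proof (rule injI)
    fix i j assume eq: "\<pi> i = \<pi> j"
    have "\<psi> g i = \<psi> g j" if g: "g \<in> G" for g
    proof (rule roots_of_unity_power_inj[OF root[OF g] root[OF g] m(2) _ m(1)])
      have "\<psi> g (\<pi> j) \<noteq> 0" using root[OF g, of "\<pi> j"] m(1) by (auto simp: power_0_left)
      then show "\<psi> g i ^ (d - 1) = \<psi> g j ^ (d - 1)"
        using \<pi>[OF g, of i] \<pi>[OF g, of j] eq by (metis mult_right_cancel)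
    qed
    then have "C i = C j" by (auto simp: C_def)
    then show "i = j" using eq h[of i] mem[of i] mem[of j] by (auto simp: \<pi>_def dest: inj_onD)
  qed
  then have "bij \<pi>" by (simp add: bij_def finite_UNIV_inj_surj)
  then show ?thesis using that \<pi> by blast
qed

section \<open>The polynomial attached to a permutation\<close>

lemma cycle_lists_of_permutation:
  fixes \<pi> :: "'n::finite \<Rightarrow> 'n"
  assumes "bij \<pi>"
  obtains xss where "[] \<notin> set xss" "distinct (concat xss)" "set (concat xss) = UNIV"
    "\<And>xs j. xs \<in> set xss \<Longrightarrow> j < length xs \<Longrightarrow> xs ! (Suc j mod length xs) = \<pi> (xs ! j)"
proof -
  have perm: "permutation \<pi>" using assms by (simp add: permutation)
  let ?orb = "\<lambda>a. set (support \<pi> a)"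
  obtain ss where ss: "set ss = range ?orb" "distinct ss"
    using finite_distinct_list[of "range ?orb"] by auto
  define r where "r s = (SOME a. ?orb a = s)" for s
  have r: "?orb (r s) = s" if "s \<in> range ?orb" for s
    using that someI[of "\<lambda>a. ?orb a = s"] unfolding r_def by blast
  define xss where "xss = map (\<lambda>s. support \<pi> (r s)) ss"
  have setx: "set ` set xss = range ?orb" using ss r by (force simp: xss_def image_image)
  have mem: "a \<in> ?orb a" for a
    using least_power_of_permutation(2)[OF perm, of a]
    unfolding set_map by (intro image_eqI[of _ _ 0]) simp_all
  have disj: "s \<inter> t = {}" if "s \<in> range ?orb" "t \<in> range ?orb" "s \<noteq> t" for s t
    using disjoint_support[OF perm] that by (auto simp: disjoint_def)
  show ?thesis
  proof (rule that)
    show "[] \<notin> set xss"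
      using least_power_of_permutation(2)[OF perm] by (auto simp: xss_def) (metis less_irrefl)
    have inj: "inj_on (\<lambda>s. support \<pi> (r s)) (set ss)"
      using r ss(1) by (intro inj_onI) metis
    show "distinct (concat xss)"
    proof (rule distinct_concat)
      show "distinct xss" unfolding xss_def using inj ss(2) by (simp add: distinct_map)
      show "distinct ys" if "ys \<in> set xss" for ys
        using that cycle_of_permutation[OF perm] by (auto simp: xss_def)
      show "set ys \<inter> set zs = {}" 
        if yz: "ys \<in> set xss" "zs \<in> set xss" "ys \<noteq> zs" for ys zs
      proof -
        obtain s t where st: "s \<in> set ss" "t \<in> set ss" "ys = support \<pi> (r s)" "zs = support \<pi> (r t)"
          using yz unfolding xss_def set_map by blast
        then have "set ys = s" "set zs = t" using r ss(1) by auto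
        moreover have "s \<noteq> t" using st yz by auto
        ultimately show ?thesis using disj st ss(1) by auto
      qed
    qed
    have "set (concat xss) = \<Union>(set ` set xss)" by simp
    also have "\<dots> = \<Union>(range ?orb)" unfolding setx ..
    also have "\<dots> = UNIV" using mem by blast
    finally show "set (concat xss) = UNIV" .
    fix xs j assume xs: "xs \<in> set xss" and j: "j < length xs"
    then obtain a where a: "xs = support \<pi> a" by (auto simp: xss_def)
    have len: "length xs = least_power \<pi> a" by (simp add: a)
    show "xs ! (Suc j mod length xs) = \<pi> (xs ! j)"
    proof (cases "Suc j = length xs")
      case True
      have "\<pi> (xs ! j) = (\<pi> ^^ Suc j) a" using j by (simp add: a)
      also have "\<dots> = a" using least_power_of_permutation(1)[OF perm, of a] True len by simp
      also have "\<dots> = xs ! 0" using j by (simp add: a)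
      finally show ?thesis using True by simp
    next
      case False
      then have "Suc j < length xs" using j by simp
      then show ?thesis by (simp add: a)
    qed
  qed
qed

lemma peval_sum_list: "peval (\<Sum>y\<leftarrow>ys. f y) x = (\<Sum>y\<leftarrow>ys. peval (f y) x)"
  by (induction ys) (simp_all add: peval_add)

text \<open>
  With the cycles of \<open>\<pi>\<close> as components, the monomials of \<open>K\<close> are the \<open>x\<^sub>i\<^sup>d\<^sup>-\<^sup>1 x\<^bsub>\<pi> i\<^esub>\<close>, and
  the diagonal matrix with entries \<open>l\<close> multiplies each of them by the same factor \<open>c\<close>.
\<close>

lemma K_pure_of_permutation:
  fixes \<pi> :: "'n::finite \<Rightarrow> 'n"
  assumes "bij \<pi>"
  obtains K :: "'n cpoly" where "K_pure d K"
    "\<And>l c x. (\<And>i. l $ i ^ (d - 1) * l $ \<pi> i = c) \<Longrightarrow> peval K (\<chi> i. l $ i * x $ i) = c * peval K x"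
proof -
  obtain xss where xss: "[] \<notin> set xss" "distinct (concat xss)" "set (concat xss) = UNIV"
    "\<And>xs j. xs \<in> set xss \<Longrightarrow> j < length xs \<Longrightarrow> xs ! (Suc j mod length xs) = \<pi> (xs ! j)"
    using cycle_lists_of_permutation[OF assms] by blast
  show ?thesis
  proof (rule that)
    show "K_pure d (\<Sum>xs\<leftarrow>xss. K_poly d xs)" unfolding K_pure_def using xss by blast
    fix l x :: "complex ^ 'n" and c
    assume l: "\<And>i. l $ i ^ (d - 1) * l $ \<pi> i = c"
    have K: "peval (K_poly d xs) y = (\<Sum>j<length xs. y $ (xs ! j) ^ (d - 1) * y $ \<pi> (xs ! j))"
      if "xs \<in> set xss" for xs y
      using that xss(4) by (simp add: K_poly_def peval_sum peval_mult peval_power)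
    have "peval (K_poly d xs) (\<chi> i. l $ i * x $ i) = c * peval (K_poly d xs) x"
      if "xs \<in> set xss" for xs
      unfolding K[OF that] sum_distrib_left
    proof (intro sum.cong refl)
      fix j
      show "(\<chi> i. l $ i * x $ i) $ (xs ! j) ^ (d - 1) * (\<chi> i. l $ i * x $ i) $ \<pi> (xs ! j)
          = c * (x $ (xs ! j) ^ (d - 1) * x $ \<pi> (xs ! j))"
        by (simp add: l[of "xs ! j", symmetric] power_mult_distrib)
    qed
    then have "(\<Sum>xs\<leftarrow>xss. peval (K_poly d xs) (\<chi> i. l $ i * x $ i)) = (\<Sum>xs\<leftarrow>xss. c * peval (K_poly d xs) x)"
      by (intro arg_cong[where f = sum_list] map_cong refl)
    then show "peval (\<Sum>xs\<leftarrow>xss. K_poly d xs) (\<chi> i. l $ i * x $ i) = c * peval (\<Sum>xs\<leftarrow>xss. K_poly d xs) x"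
      by (simp add: peval_sum_list sum_list_const_mult)
  qed
qed

section \<open>The projective linear group\<close>

lemma group_GL: "group (GL :: (complex ^ 'n ^ 'n) monoid)"
proof (rule groupI)
  fix A :: "complex ^ 'n ^ 'n" assume "A \<in> carrier GL"
  then obtain B where "A ** B = mat 1" "B ** A = mat 1" by (auto simp: GL_def invertible_def)
  then show "\<exists>B\<in>carrier GL. B \<otimes>\<^bsub>GL\<^esub> A = \<one>\<^bsub>GL\<^esub>"
    by (intro bexI[of _ B]) (auto simp: GL_def invertible_def)
next
  show "\<one>\<^bsub>GL\<^esub> \<in> carrier (GL :: (complex ^ 'n ^ 'n) monoid)"
    by (auto simp: GL_def invertible_def intro: exI[of _ "mat 1"])
qed (auto simp: GL_def invertible_mult matrix_mul_assoc)

lemma scalar_matrix_mult: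
  fixes A :: "complex ^ 'n ^ 'n"
  shows "mat c ** A = (\<chi> i j. c * A $ i $ j)" "A ** mat c = (\<chi> i j. c * A $ i $ j)"
  by (simp_all add: matrix_matrix_mult_def mat_def vec_eq_iff if_distrib[of "\<lambda>a. a * _"] if_distrib[of "\<lambda>a. _ * a"]
      mult.commute cong: if_cong)

lemma scalar_matrices_normal: "scalar_matrices \<lhd> (GL :: (complex ^ 'n ^ 'n) monoid)"
proof -
  interpret GL: group "GL :: (complex ^ 'n ^ 'n) monoid" by (rule group_GL)
  have mm: "mat a ** mat b = (mat (a * b) :: complex ^ 'n ^ 'n)" for a b
    unfolding scalar_matrix_mult by (simp add: vec_eq_iff mat_def)
  have sub: "scalar_matrices \<subseteq> carrier (GL :: (complex ^ 'n ^ 'n) monoid)"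
  proof
    fix A :: "complex ^ 'n ^ 'n" assume "A \<in> scalar_matrices"
    then obtain c where "A = mat c" "c \<noteq> 0" by (auto simp: scalar_matrices_def)
    then have "A ** mat (1 / c) = mat 1 \<and> mat (1 / c) ** A = mat 1" by (simp add: mm)
    then show "A \<in> carrier GL" by (auto simp: GL_def invertible_def)
  qed
  have "subgroup scalar_matrices (GL :: (complex ^ 'n ^ 'n) monoid)"
  proof (rule GL.subgroupI)
    show "scalar_matrices \<noteq> ({} :: (complex ^ 'n ^ 'n) set)"
      by (auto simp: scalar_matrices_def intro: exI[of _ 1])
    fix A :: "complex ^ 'n ^ 'n" assume A: "A \<in> scalar_matrices"
    then obtain c where c: "A = mat c" "c \<noteq> 0" by (auto simp: scalar_matrices_def)
    then have inv: "mat (1 / c) \<in> (scalar_matrices :: (complex ^ 'n ^ 'n) set)"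
      by (auto simp: scalar_matrices_def)
    have "inv\<^bsub>GL\<^esub> A = mat (1 / c)"
      using c sub inv A by (intro GL.inv_equality) (auto simp: GL_def mm)
    then show "inv\<^bsub>GL\<^esub> A \<in> scalar_matrices" using inv by simp
    fix B :: "complex ^ 'n ^ 'n" assume "B \<in> scalar_matrices"
    then obtain b where "B = mat b" "b \<noteq> 0" by (auto simp: scalar_matrices_def)
    then show "A \<otimes>\<^bsub>GL\<^esub> B \<in> scalar_matrices" using c by (auto simp: GL_def mm scalar_matrices_def)
  qed (rule sub)
  then show ?thesis
  proof (rule GL.normalI, intro ballI)
    fix A :: "complex ^ 'n ^ 'n"
    show "scalar_matrices #>\<^bsub>GL\<^esub> A = A <#\<^bsub>GL\<^esub> scalar_matrices"
      by (auto simp: r_coset_def l_coset_def scalar_matrices_def GL_def scalar_matrix_mult)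
  qed
qed

lemma group_PGL: "group (PGL :: (complex ^ 'n ^ 'n) set monoid)"
  unfolding PGL_def by (rule normal.factorgroup_is_group[OF scalar_matrices_normal])

lemma PGL_class_hom: "PGL_class \<in> hom GL (PGL :: (complex ^ 'n ^ 'n) set monoid)"
  using normal.r_coset_hom_Mod[OF scalar_matrices_normal]
  unfolding PGL_def PGL_class_def[abs_def] .

lemma PGL_class_group_hom: "group_hom GL (PGL :: (complex ^ 'n ^ 'n) set monoid) PGL_class"
  by (intro group_hom.intro group_hom_axioms.intro group_GL group_PGL PGL_class_hom)

lemma mem_PGL_class: "A \<in> PGL_class A"
proof -
  have one: "mat 1 \<in> scalar_matrices" by (auto simp: scalar_matrices_def intro: exI[of _ 1])
  have "A \<in> (\<Union>h\<in>scalar_matrices. {h ** A})" by (rule UN_I[OF one]) simp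
  then show ?thesis unfolding PGL_class_def r_coset_def by (simp add: GL_def)
qed

lemma PGL_act_preserves_zeros:
  fixes F :: "'n::finite cpoly"
  assumes hom: "homogeneous d F" "d \<ge> 1"
    and inv: "PGL_act (PGL_class A) ` hypersurface F = hypersurface F" and x: "peval F x = 0"
  shows "peval F (A *v x) = 0"
proof (cases "x = 0")
  case False
  then have "proj_point x \<in> hypersurface F" using x by (auto simp: hypersurface_def)
  then have "PGL_act (PGL_class A) (proj_point x) \<in> hypersurface F" using inv by blast
  then obtain y where y: "PGL_act (PGL_class A) (proj_point x) = proj_point y" "peval F y = 0"
    by (auto simp: hypersurface_def)
  have "x = 1 *s x" "(1 :: complex) \<noteq> 0" by simp_all
  then have "x \<in> proj_point x" unfolding proj_point_def by blast
  then have "A *v x \<in> PGL_act (PGL_class A) (proj_point x)"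
    using mem_PGL_class[of A] by (auto simp: PGL_act_def)
  then obtain c where "A *v x = c *s y" using y(1) by (auto simp: proj_point_def)
  then show ?thesis using y(2) peval_scale[OF hom(1)] by simp
qed (use x in simp)

text \<open>
  The inverse in \<open>G\<lparr>carrier := S\<rparr>\<close> is a definite description over \<open>S\<close>; it denotes \<open>inv x\<close> because
  \<open>inv x \<in> H \<subseteq> S\<close> and inverses are unique in all of \<open>G\<close>.
\<close>

lemma (in group) subgroup_of_intermediate_set:
  assumes H: "subgroup H G" and HS: "H \<subseteq> S" and S: "S \<subseteq> carrier G"
  shows "subgroup H (G\<lparr>carrier := S\<rparr>)"
proof (rule subgroup.intro)
  fix x assume x: "x \<in> H"
  have iH: "inv x \<in> H" using H x by (rule subgroup.m_inv_closed)
  have xG: "x \<in> carrier G" using x HS S by blast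
  have "inv\<^bsub>G\<lparr>carrier := S\<rparr>\<^esub> x = inv x"
    unfolding m_inv_def[of "G\<lparr>carrier := S\<rparr>"]
  proof (rule the_equality)
    show "inv x \<in> carrier (G\<lparr>carrier := S\<rparr>) \<and>
        x \<otimes>\<^bsub>G\<lparr>carrier := S\<rparr>\<^esub> inv x = \<one>\<^bsub>G\<lparr>carrier := S\<rparr>\<^esub> \<and>
        inv x \<otimes>\<^bsub>G\<lparr>carrier := S\<rparr>\<^esub> x = \<one>\<^bsub>G\<lparr>carrier := S\<rparr>\<^esub>"
      using iH HS xG by auto
    fix y assume "y \<in> carrier (G\<lparr>carrier := S\<rparr>) \<and>
        x \<otimes>\<^bsub>G\<lparr>carrier := S\<rparr>\<^esub> y = \<one>\<^bsub>G\<lparr>carrier := S\<rparr>\<^esub> \<and>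
        y \<otimes>\<^bsub>G\<lparr>carrier := S\<rparr>\<^esub> x = \<one>\<^bsub>G\<lparr>carrier := S\<rparr>\<^esub>"
    then show "y = inv x" using inv_equality[of y x] xG S by auto
  qed
  then show "inv\<^bsub>G\<lparr>carrier := S\<rparr>\<^esub> x \<in> H" using iH by simp
qed (use HS subgroup.m_closed[OF H] subgroup.one_closed[OF H] in auto)

section \<open>Abelian groups acting on smooth hypersurfaces\<close>

theorem theorem4p2:
  fixes d :: nat
    and G :: "('a, 'b) monoid_scheme"
    and F :: "'n::finite cpoly"
    and \<rho> :: "'a \<Rightarrow> (complex ^ 'n ^ 'n) set"
  assumes "d \<ge> 3" and "CARD('n) \<ge> 3"
    and "comm_group G" and "finite (carrier G)"
    and "homogeneous d F" and "smooth_poly F"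
    and "linear_action G F \<rho>" and "faithful_action G \<rho>" and "liftable G \<rho>"
    and "gcd (order G) (d - 1) = 1"
  shows "\<exists>C \<in> carrier GL. \<exists>K :: 'n cpoly. K_pure d K \<and>
    subgroup
      ((\<lambda>g. PGL_class C \<otimes>\<^bsub>PGL\<^esub> \<rho> g \<otimes>\<^bsub>PGL\<^esub> inv\<^bsub>PGL\<^esub> (PGL_class C)) ` carrier G)
      (PGL\<lparr>carrier := diag_sym K\<rparr>)"
proof -
  interpret G: comm_group G by fact
  interpret PC: group_hom GL "PGL :: (complex ^ 'n ^ 'n) set monoid" PGL_class
    by (rule PGL_class_group_hom)
  obtain \<sigma> where \<sigma>: "\<sigma> \<in> hom G GL" and \<sigma>\<rho>: "\<And>g. g \<in> carrier G \<Longrightarrow> PGL_class (\<sigma> g) = \<rho> g"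
    using \<open>liftable G \<rho>\<close> by (auto simp: liftable_def)
  interpret \<sigma>: group_hom G "GL :: (complex ^ 'n ^ 'n) monoid" \<sigma>
    by (intro group_hom.intro group_hom_axioms.intro G.is_group group_GL \<sigma>)
  define m where "m = order G"
  have m: "1 \<le> m" using \<open>finite (carrier G)\<close> by (simp add: m_def Suc_le_eq G.order_gt_0_iff_finite)
  have \<sigma>mult: "\<sigma> (g \<otimes>\<^bsub>G\<^esub> h) = \<sigma> g ** \<sigma> h" if "g \<in> carrier G" "h \<in> carrier G" for g h
    using \<sigma>.hom_mult[OF that] by (simp add: GL_def)
  have \<sigma>inv: "invertible (\<sigma> g)" if "g \<in> carrier G" for g
    using \<sigma>.hom_closed[OF that] by (simp add: GL_def)
  have \<sigma>pow: "(((*v) (\<sigma> g)) ^^ k) x = \<sigma> (g [^]\<^bsub>G\<^esub> k) *v x" if g: "g \<in> carrier G" for g k x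
  proof (induction k arbitrary: x)
    case 0
    have "\<sigma> \<one>\<^bsub>G\<^esub> = mat 1" using \<sigma>.hom_one by (simp add: GL_def)
    then show ?case by simp
  next
    case (Suc k)
    then show ?case using g by (simp add: funpow_Suc_right \<sigma>mult matrix_vector_mul_assoc del: funpow.simps \<sigma>.hom_mult)
  qed
  have per: "(((*v) (\<sigma> g)) ^^ m) x = x" if "g \<in> carrier G" for g x
    using \<sigma>pow[OF that, of m x] G.power_order_eq_one[OF \<open>finite (carrier G)\<close> that] \<sigma>.hom_one
    by (simp add: m_def order_def GL_def)
  have finS: "finite (\<sigma> ` carrier G)" using \<open>finite (carrier G)\<close> by simp
  have perS: "(((*v) A) ^^ m) x = x" if "A \<in> \<sigma> ` carrier G" for A x
    using that per by blast
  have commS: "A ** B = B ** A" if "A \<in> \<sigma> ` carrier G" "B \<in> \<sigma> ` carrier G" for A B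
    using that by (auto simp: \<sigma>mult[symmetric] G.m_comm simp del: \<sigma>.hom_mult)
  obtain P P' :: "complex ^ 'n ^ 'n" where P: "P ** P' = mat 1" "P' ** P = mat 1"
    and ev: "\<And>A i. A \<in> \<sigma> ` carrier G \<Longrightarrow> \<exists>c. A *v column i P = c *s column i P"
    using simultaneous_diagonalization[OF finS m perS commS] by blast
  have "\<forall>g i. \<exists>c. g \<in> carrier G \<longrightarrow> \<sigma> g *v column i P = c *s column i P"
    using ev by blast
  then obtain l where l: "\<And>g i. g \<in> carrier G \<Longrightarrow> \<sigma> g *v column i P = l g i *s column i P"
    using ev by metis
  have root: "l g i ^ m = 1" if g: "g \<in> carrier G" for g i
  proof -
    have "(((*v) (\<sigma> g)) ^^ k) (column i P) = l g i ^ k *s column i P" for k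
      by (induction k) (simp_all add: l[OF g] vector_scalar_commute mult.commute)
    then have eq: "l g i ^ m *s column i P = column i P" using per[OF g] by metis
    have "column i P \<noteq> 0"
    proof
      assume "column i P = 0"
      then have "P *v axis i 1 = 0"
        unfolding matrix_vector_mult_columns by (intro sum.neutral) (auto simp: axis_def)
      then have "P' *v (P *v axis i 1) = 0" by simp
      then have "axis i (1 :: complex) = 0" by (simp add: matrix_vector_mul_assoc P)
      then show False by simp
    qed
    then obtain k where "column i P $ k \<noteq> 0" by (auto simp: vec_eq_iff)
    then show ?thesis using arg_cong[OF eq, of "\<lambda>v. v $ k"] by simp
  qed
  have d: "1 \<le> d" "2 \<le> d" and n: "2 \<le> CARD('n)" using \<open>d \<ge> 3\<close> \<open>CARD('n) \<ge> 3\<close> by auto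
  have "\<exists>c. g \<in> carrier G \<longrightarrow> c \<noteq> 0 \<and> (\<forall>x. peval F (\<sigma> g *v x) = c * peval F x)" for g
  proof (cases "g \<in> carrier G")
    case True
    have "PGL_act (PGL_class (\<sigma> g)) ` hypersurface F = hypersurface F"
      using \<open>linear_action G F \<rho>\<close> True by (simp add: linear_action_def \<sigma>\<rho>)
    then have zeros: "peval F (\<sigma> g *v x) = 0" if "peval F x = 0" for x
      using PGL_act_preserves_zeros[OF \<open>homogeneous d F\<close> d(1)] that by blast
    show ?thesis
      using invariant_hypersurface_semi_invariant[OF \<open>homogeneous d F\<close> \<open>smooth_poly F\<close> d(1) n \<sigma>inv[OF True] zeros]
      by blast
  qed simp
  then obtain \<kappa> where \<kappa>0: "\<And>g. g \<in> carrier G \<Longrightarrow> \<kappa> g \<noteq> 0"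
    and \<kappa>: "\<And>g x. g \<in> carrier G \<Longrightarrow> peval F (\<sigma> g *v x) = \<kappa> g * peval F x" by metis
  have cop: "coprime m (d - 1)" using \<open>gcd (order G) (d - 1) = 1\<close> by (simp add: m_def coprime_iff_gcd_eq_1)
  obtain \<pi> where \<pi>: "bij \<pi>" "\<And>g i. g \<in> carrier G \<Longrightarrow> l g i ^ (d - 1) * l g (\<pi> i) = \<kappa> g"
    by (rule character_permutation[where G = "carrier G" and \<sigma> = \<sigma> and \<psi> = l and \<kappa> = \<kappa>,
          OF d(2) \<open>homogeneous d F\<close> \<open>smooth_poly F\<close> P l \<kappa> m cop root]) (assumption | blast intro: that)+
  obtain K :: "'n cpoly" where K: "K_pure d K"
    "\<And>l c x. (\<And>i. l $ i ^ (d - 1) * l $ \<pi> i = c) \<Longrightarrow> peval K (\<chi> i. l $ i * x $ i) = c * peval K x"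
    by (rule K_pure_of_permutation[OF \<pi>(1), of d]) (blast intro: that)
  define D where "D g = diag_matrix (\<chi> i. l g i)" for g
  have conj: "P' ** \<sigma> g ** P = D g" if g: "g \<in> carrier G" for g
  proof -
    have "\<sigma> g ** P = P ** D g"
    proof -
      have "(\<sigma> g ** P) $ i $ j = (P ** D g) $ i $ j" for i j
      proof -
        have "(\<sigma> g ** P) $ i $ j = (\<sigma> g *v column j P) $ i"
          by (simp add: matrix_matrix_mult_def matrix_vector_mult_def column_def)
        also have "\<dots> = l g j * P $ i $ j" unfolding l[OF g] by (simp add: column_def)
        also have "\<dots> = (P ** D g) $ i $ j"
          by (simp add: matrix_matrix_mult_def D_def diag_matrix_def if_distrib[of "\<lambda>a. _ * a"] mult.commute cong: if_cong)
        finally show ?thesis .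
      qed
      then show ?thesis by (simp add: vec_eq_iff)
    qed
    then have "P' ** \<sigma> g ** P = P' ** P ** D g" by (simp add: matrix_mul_assoc[symmetric])
    then show ?thesis by (simp add: P)
  qed
  have P'GL: "P' \<in> carrier GL" and PGL: "P \<in> carrier GL" using P by (auto simp: GL_def invertible_def)
  have invP': "inv\<^bsub>GL\<^esub> P' = P"
    using group.inv_equality[OF group_GL, of P P'] P P'GL PGL by (simp add: GL_def)
  let ?\<Phi> = "\<lambda>g. PGL_class P' \<otimes>\<^bsub>PGL\<^esub> \<rho> g \<otimes>\<^bsub>PGL\<^esub> inv\<^bsub>PGL\<^esub> (PGL_class P')"
  have \<Phi>: "?\<Phi> g = PGL_class (D g)" if g: "g \<in> carrier G" for g
  proof -
    have "?\<Phi> g = PGL_class (P' \<otimes>\<^bsub>GL\<^esub> \<sigma> g \<otimes>\<^bsub>GL\<^esub> inv\<^bsub>GL\<^esub> P')"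
      using g P'GL by (simp add: \<sigma>\<rho>[OF g, symmetric])
    then show ?thesis unfolding invP' using conj[OF g] by (simp add: GL_def)
  qed
  have "?\<Phi> \<in> hom G PGL"
  proof (rule homI)
    fix g assume g: "g \<in> carrier G"
    then show "?\<Phi> g \<in> carrier PGL" using P'GL by (simp add: \<sigma>\<rho>[symmetric])
  next
    fix g h assume gh: "g \<in> carrier G" "h \<in> carrier G"
    have D: "D k \<in> carrier GL" if "k \<in> carrier G" for k
      using conj[OF that, symmetric] P'GL PGL \<sigma>inv[OF that] by (simp add: GL_def invertible_mult)
    have "D (g \<otimes>\<^bsub>G\<^esub> h) = (P' ** \<sigma> g ** P) ** (P' ** \<sigma> h ** P)"
    proof -
      have "(P' ** \<sigma> g ** P) ** (P' ** \<sigma> h ** P) = P' ** \<sigma> g ** (P ** P') ** \<sigma> h ** P"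
        by (simp add: matrix_mul_assoc)
      then show ?thesis using gh by (simp add: P conj[symmetric] \<sigma>mult matrix_mul_assoc del: \<sigma>.hom_mult)
    qed
    then have "D (g \<otimes>\<^bsub>G\<^esub> h) = D g \<otimes>\<^bsub>GL\<^esub> D h" using gh by (simp add: conj GL_def)
    then show "?\<Phi> (g \<otimes>\<^bsub>G\<^esub> h) = ?\<Phi> g \<otimes>\<^bsub>PGL\<^esub> ?\<Phi> h"
      using gh D by (simp only: \<Phi> G.m_closed PC.hom_mult)
  qed
  then have "group_hom G PGL ?\<Phi>"
    by (intro group_hom.intro group_hom_axioms.intro G.is_group group_PGL)
  then have sub: "subgroup (?\<Phi> ` carrier G) PGL" by (rule group_hom.img_is_subgroup)
  have "?\<Phi> ` carrier G \<subseteq> diag_sym K"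
  proof
    fix X assume "X \<in> ?\<Phi> ` carrier G"
    then obtain g where g: "g \<in> carrier G" "X = PGL_class (diag_matrix (\<chi> i. l g i))"
      using \<Phi> by (auto simp: D_def)
    have "l g i \<noteq> 0" for i using root[OF g(1), of i] m by (auto simp: power_0_left)
    moreover have "peval K (\<chi> i. (\<chi> i. l g i) $ i * x $ i) = \<kappa> g * peval K x" for x
      using \<pi>(2)[OF g(1)] by (intro K(2)) simp
    ultimately show "X \<in> diag_sym K"
      unfolding diag_sym_def g(2) using \<kappa>0[OF g(1)]
      by (intro CollectI exI[of _ "\<chi> i. l g i"] conjI refl allI exI[of _ "\<kappa> g"]) simp_all
  qed
  moreover have "diag_sym K \<subseteq> carrier PGL"
  proof
    fix X assume "X \<in> diag_sym K"
    then obtain l where l: "X = PGL_class (diag_matrix l)" "\<And>i. l $ i \<noteq> 0" by (auto simp: diag_sym_def)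
    let ?l' = "diag_matrix (\<chi> i. 1 / l $ i)"
    have "diag_matrix l ** ?l' = mat 1" "?l' ** diag_matrix l = mat 1"
      using l(2) by (simp_all add: diag_matrix_def matrix_matrix_mult_def mat_def vec_eq_iff
          if_distrib[of "\<lambda>a. a * _"] if_distrib[of "\<lambda>a. _ * a"] cong: if_cong)
    then have "diag_matrix l \<in> carrier GL" by (auto simp: GL_def invertible_def)
    then show "X \<in> carrier PGL" unfolding l(1) by (rule PC.hom_closed)
  qed
  ultimately have "subgroup (?\<Phi> ` carrier G) (PGL\<lparr>carrier := diag_sym K\<rparr>)"
    by (rule group.subgroup_of_intermediate_set[OF group_PGL sub])
  then show ?thesis using K(1) P'GL by blast
qed

end
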